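(* Let $D\in\mathbb{N}$, let $\boldsymbol{d}=(d_1,\dots,d_D)\in\mathbb{N}^D$ be a spatial dimension, $c,c'\in\mathbb{N}$ channel sizes, and $\sigma:\mathbb{R}\to\mathbb{R}$ a non-polynomial continuous activation function. Define $$N_{\boldsymbol{d}}=\begin{cases}2 & \text{if } \max_i d_i\in\{1,2\},\\ 3 & \text{if } \max_i d_i=3,\\ \max_i d_i-1 & \text{if } \max_i d_i\ge 4.\end{cases}$$ Then $N_{\boldsymbol{d}}$ is the minimum depth required for three-kernel, $D$-dimensional CNNs to have the universal approximation property, in the following sense: for every compact set $K\subset\mathbb{R}^{c\times\boldsymbol{d}}$, $$\overline{\Sigma^{\sigma,\boldsymbol{d},3\boldsymbol{1}_D}_{N_{\boldsymbol{d}},c,c'}}=C(K,\mathbb{R}^{c'\times\boldsymbol{d}}),$$ and there exists a compact set $K\subset\mathbb{R}^{c\times\boldsymbol{d}}$ such that $$\overline{\Sigma^{\sigma,\boldsymbol{d},3\boldsymbol{1}_D}_{N_{\boldsymbol{d}}-1,c,c'}}\nsupseteq C(K,\mathbb{R}^{c'\times\boldsymbol{d}}).$$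
   Context: $\mathbb{N}=\{1,2,\dots\}$; $C(X,Y)$ is the set of continuous functions from $X$ to $Y$. For $\boldsymbol{d}=(d_1,\dots,d_D)\in\mathbb{N}^D$, $\mathbb{R}^{\boldsymbol{d}}=\mathbb{R}^{d_1\times\cdots\times d_D}$ with entries $x_{\boldsymbol{i}}$, $\boldsymbol{i}\in\prod_{t=1}^D\{1,\dots,d_t\}$, and $\mathbb{R}^{c\times\boldsymbol{d}}$ consists of $x=(x^1,\dots,x^c)$ with channels $x^i\in\mathbb{R}^{\boldsymbol{d}}$. $\boldsymbol{1}_{\boldsymbol{d}}\in\mathbb{R}^{\boldsymbol{d}}$ is the all-ones tensor; $3\boldsymbol{1}_D=(3,\dots,3)$. Inequalities and absolute values of multi-indices are componentwise. Zero-padding convolution: for $\boldsymbol{k}=(k_1,\dots,k_D)$, a kernel $w=(w_{\boldsymbol{j}})_{|\boldsymbol{j}|\le\boldsymbol{k}}\in\mathbb{R}^{2\boldsymbol{k}+1}$ (kernel size $2\boldsymbol{k}+1=(2k_1+1,\dots,2k_D+1)$) and $x\in\mathbb{R}^{\boldsymbol{d}}$, $w\circledast x\in\mathbb{R}^{\boldsymbol{d}}$ is given by $(w\circledast x)_{\boldsymbol{i}}=\sum_{|\boldsymbol{j}|\le\boldsymbol{k}}w_{\boldsymbol{j}}x_{\boldsymbol{i}-\boldsymbol{j}}$, where $x_{\boldsymbol{m}}=0$ if $\boldsymbol{m}\notin\prod_t\{1,\dots,d_t\}$. Convolutional layers: $\mathcal{L}^{\boldsymbol{d},2\boldsymbol{k}+1}_{c_1,c_2}$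 is the set of maps $f=(f^1,\dots,f^{c_2}):\mathbb{R}^{c_1\times\boldsymbol{d}}\to\mathbb{R}^{c_2\times\boldsymbol{d}}$ of the form $f^i(x)=\sum_{j=1}^{c_1}w_{i,j}\circledast x^j+\delta_i\boldsymbol{1}_{\boldsymbol{d}}$ with $w_{i,j}\in\mathbb{R}^{2\boldsymbol{k}+1}$, $\delta_i\in\mathbb{R}$. CNNs: $\sigma$ is applied componentwise. $\Sigma^{\sigma,\boldsymbol{d},2\boldsymbol{k}+1}_{N,c,c'}$ is the set of all functions $C_N\circ\sigma\circ C_{N-1}\circ\cdots\circ\sigma\circ C_1:\mathbb{R}^{c\times\boldsymbol{d}}\to\mathbb{R}^{c'\times\boldsymbol{d}}$ with $C_i\in\mathcal{L}^{\boldsymbol{d},2\boldsymbol{k}+1}_{c_{i-1},c_i}$, $c_0=c$, $c_N=c'$ and arbitrary $c_1,\dots,c_{N-1}\in\mathbb{N}$. For a compact $K\subset\mathbb{R}^{c\times\boldsymbol{d}}$ its elements are restricted to $K$, and the overline denotes closure in $C(K,\mathbb{R}^{c'\times\boldsymbol{d}})$ with respect to the uniform norm $\|f\|_{\infty,K}=\sup_{x\in K}\|f(x)\|_\infty$. *)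

theory Defs
  imports "HOL-Analysis.Analysis" "HOL-Computational_Algebra.Polynomial"
begin

text \<open>
  The spatial dimension \<open>D\<close> is \<open>CARD('n)\<close>; a spatial size \<open>d\<close> is a vector in \<open>nat ^ 'n\<close>, and
  multi-indices are integer vectors, so that \<open>i - j\<close> is meaningful also outside the index range.
\<close>

type_synonym 'n tensor = "int ^ 'n \<Rightarrow> real"
type_synonym 'n ctensor = "nat \<Rightarrow> 'n tensor"

definition indices :: "nat ^ 'n \<Rightarrow> (int ^ 'n) set" where
  "indices d = {i. \<forall>t. 1 \<le> i $ t \<and> i $ t \<le> int (d $ t)}"

text \<open>
  A tensor is represented by its extension by \<open>0\<close> to all multi-indices (this is exactly the zero
  padding); channels are numbered from \<open>1\<close>, and unused channels are \<open>0\<close> as well.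
\<close>

definition ctensors :: "nat \<Rightarrow> nat ^ 'n \<Rightarrow> 'n ctensor set" where
  "ctensors c d = {x. \<forall>j i. \<not> (j \<in> {1..c} \<and> i \<in> indices d) \<longrightarrow> x j i = 0}"

text \<open>Including \<open>0\<close> in the maximum only matters when there are no entries at all.\<close>

definition sup_norm :: "nat \<Rightarrow> nat ^ 'n \<Rightarrow> 'n ctensor \<Rightarrow> real" where
  "sup_norm c d x = Max (insert 0 ((\<lambda>(j, i). \<bar>x j i\<bar>) ` ({1..c} \<times> indices d)))"

definition ctensor_metric :: "nat \<Rightarrow> nat ^ 'n \<Rightarrow> 'n ctensor metric" where
  "ctensor_metric c d = metric (ctensors c d, \<lambda>x y. sup_norm c d (\<lambda>j i. x j i - y j i))"

abbreviation ctensor_topology :: "nat \<Rightarrow> nat ^ 'n \<Rightarrow> 'n ctensor topology" where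
  "ctensor_topology c d \<equiv> mtopology_of (ctensor_metric c d)"

definition kernel_range :: "nat ^ 'n \<Rightarrow> (int ^ 'n) set" where
  "kernel_range k = {j. \<forall>t. \<bar>j $ t\<bar> \<le> int (k $ t)}"

definition conv :: "nat ^ 'n \<Rightarrow> nat ^ 'n \<Rightarrow> 'n tensor \<Rightarrow> 'n tensor \<Rightarrow> 'n tensor" where
  "conv d k w x = (\<lambda>i. if i \<in> indices d then \<Sum>j\<in>kernel_range k. w j * x (i - j) else 0)"

definition ones :: "nat ^ 'n \<Rightarrow> 'n tensor" where
  "ones d = (\<lambda>i. if i \<in> indices d then 1 else 0)"

text \<open>
  In the following, the parameter \<open>k\<close> is the kernel radius: the kernel size is \<open>2 * k + 1\<close>.
\<close>

definition conv_layer ::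
  "nat ^ 'n \<Rightarrow> nat ^ 'n \<Rightarrow> nat \<Rightarrow> nat \<Rightarrow> (nat \<Rightarrow> nat \<Rightarrow> 'n tensor) \<Rightarrow> (nat \<Rightarrow> real) \<Rightarrow>
    'n ctensor \<Rightarrow> 'n ctensor" where
  "conv_layer d k c1 c2 w \<delta> x =
    (\<lambda>i p. if i \<in> {1..c2} then (\<Sum>j = 1..c1. conv d k (w i j) (x j) p) + \<delta> i * ones d p else 0)"

definition conv_layers ::
  "nat ^ 'n \<Rightarrow> nat ^ 'n \<Rightarrow> nat \<Rightarrow> nat \<Rightarrow> ('n ctensor \<Rightarrow> 'n ctensor) set" where
  "conv_layers d k c1 c2 = {conv_layer d k c1 c2 w \<delta> | w \<delta>. True}"

text \<open>
  The activation acts on the actual entries only, since \<open>\<sigma> 0\<close> need not be \<open>0\<close>.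
\<close>

definition activate :: "(real \<Rightarrow> real) \<Rightarrow> nat \<Rightarrow> nat ^ 'n \<Rightarrow> 'n ctensor \<Rightarrow> 'n ctensor" where
  "activate \<sigma> c d x = (\<lambda>j i. if j \<in> {1..c} \<and> i \<in> indices d then \<sigma> (x j i) else 0)"

text \<open>\<open>cnns \<sigma> d k c N c'\<close> is the set of CNNs of depth \<open>N\<close>; it is empty for \<open>N = 0\<close>.\<close>

inductive is_cnn ::
  "(real \<Rightarrow> real) \<Rightarrow> nat ^ 'n \<Rightarrow> nat ^ 'n \<Rightarrow> nat \<Rightarrow> nat \<Rightarrow> nat \<Rightarrow> ('n ctensor \<Rightarrow> 'n ctensor) \<Rightarrow> bool"
  for \<sigma> d k c where
  single: "C \<in> conv_layers d k c c' \<Longrightarrow> is_cnn \<sigma> d k c 1 c' C"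
| layer: "\<lbrakk>is_cnn \<sigma> d k c N m f; m \<ge> 1; C \<in> conv_layers d k m c'\<rbrakk>
    \<Longrightarrow> is_cnn \<sigma> d k c (Suc N) c' (C \<circ> activate \<sigma> m d \<circ> f)"

definition cnns ::
  "(real \<Rightarrow> real) \<Rightarrow> nat ^ 'n \<Rightarrow> nat ^ 'n \<Rightarrow> nat \<Rightarrow> nat \<Rightarrow> nat \<Rightarrow> ('n ctensor \<Rightarrow> 'n ctensor) set" where
  "cnns \<sigma> d k N c c' = {f. is_cnn \<sigma> d k c N c' f}"

text \<open>
  For compact \<open>K\<close> the library's space of bounded continuous functions with the supremum metric is
  \<open>C(K, \<real>\<^bsup>c' \<times> d\<^esup>)\<close>; its elements are extensional, i.e. normalised to \<open>undefined\<close> off \<open>K\<close>.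
\<close>

definition C_space :: "'n ctensor set \<Rightarrow> nat \<Rightarrow> nat \<Rightarrow> nat ^ 'n \<Rightarrow> ('n ctensor \<Rightarrow> 'n ctensor) metric" where
  "C_space K c c' d = cfunspace (subtopology (ctensor_topology c d) K) (ctensor_metric c' d)"

definition cnn_closure ::
  "(real \<Rightarrow> real) \<Rightarrow> nat ^ 'n \<Rightarrow> nat ^ 'n \<Rightarrow> nat \<Rightarrow> nat \<Rightarrow> nat \<Rightarrow> 'n ctensor set \<Rightarrow>
    ('n ctensor \<Rightarrow> 'n ctensor) set" where
  "cnn_closure \<sigma> d k N c c' K =
    mtopology_of (C_space K c c' d) closure_of ((\<lambda>f. restrict f K) ` cnns \<sigma> d k N c c')"

definition min_depth :: "nat ^ 'n \<Rightarrow> nat" where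
  "min_depth d = (let m = Max (range (\<lambda>t. d $ t)) in
    if m \<in> {1, 2} then 2 else if m = 3 then 3 else m - 1)"


lemma finite_bounded_int_vec: "finite {j :: int ^ 'n. \<forall>t. a t \<le> j $ t \<and> j $ t \<le> b t}"
proof (rule finite_subset)
  show "{j :: int ^ 'n. \<forall>t. a t \<le> j $ t \<and> j $ t \<le> b t}
      \<subseteq> vec_lambda ` (PiE UNIV (\<lambda>t. {a t..b t}))"
  proof
    fix j :: "int ^ 'n"
    assume j: "j \<in> {j. \<forall>t. a t \<le> j $ t \<and> j $ t \<le> b t}"
    have "j = vec_lambda (($) j)" by simp
    moreover have "($) j \<in> PiE UNIV (\<lambda>t. {a t..b t})" using j by auto
    ultimately show "j \<in> vec_lambda ` (PiE UNIV (\<lambda>t. {a t..b t}))" by blast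
  qed
  show "finite (vec_lambda ` (PiE (UNIV :: 'n set) (\<lambda>t. {a t..b t})))"
    by (intro finite_imageI finite_PiE) auto
qed

lemma finite_indices [simp]: "finite (indices d)"
  unfolding indices_def by (rule finite_bounded_int_vec)

lemma finite_kernel_range [simp]: "finite (kernel_range k)"
proof -
  have "kernel_range k = {j. \<forall>t. - int (k $ t) \<le> j $ t \<and> j $ t \<le> int (k $ t)}"
    unfolding kernel_range_def by (intro Collect_cong all_cong1) linarith
  then show ?thesis by (simp only: finite_bounded_int_vec)
qed

lemma sup_norm_le_iff:
  "sup_norm c d x \<le> B \<longleftrightarrow> 0 \<le> B \<and> (\<forall>j\<in>{1..c}. \<forall>i\<in>indices d. \<bar>x j i\<bar> \<le> B)"
  unfolding sup_norm_def by (subst Max_le_iff) auto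

lemma Metric_space_ctensors:
  "Metric_space (ctensors c d) (\<lambda>x y. sup_norm c d (\<lambda>j i. x j i - y j i))"
proof
  fix x y z :: "'a ctensor"
  let ?n = "\<lambda>x y :: 'a ctensor. sup_norm c d (\<lambda>j i. x j i - y j i)"
  have le: "\<bar>x j i - y j i\<bar> \<le> ?n x y" if "j \<in> {1..c}" "i \<in> indices d" for x y j i
    using sup_norm_le_iff[of c d "\<lambda>j i. x j i - y j i" "?n x y"] that by blast
  show nn: "0 \<le> ?n x y" for x y
    using sup_norm_le_iff[of c d "\<lambda>j i. x j i - y j i" "?n x y"] by blast
  show "?n x y = ?n y x"
    by (simp add: sup_norm_def abs_minus_commute)
  show "?n x y = 0 \<longleftrightarrow> x = y" if "x \<in> ctensors c d" "y \<in> ctensors c d"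
  proof
    assume 0: "?n x y = 0"
    show "x = y"
    proof (intro ext)
      fix j i
      show "x j i = y j i"
      proof (cases "j \<in> {1..c} \<and> i \<in> indices d")
        case True
        then show ?thesis using le[of j i x y] 0 by simp
      next
        case False
        then have "x j i = 0" "y j i = 0" using that unfolding ctensors_def by blast+
        then show ?thesis by simp
      qed
    qed
  next
    assume "x = y"
    then have "?n x y \<le> 0" by (subst sup_norm_le_iff) auto
    then show "?n x y = 0" using nn[of x y] by simp
  qed
  show "?n x z \<le> ?n x y + ?n y z"
  proof (subst sup_norm_le_iff, intro conjI ballI)
    show "0 \<le> ?n x y + ?n y z" using nn[of x y] nn[of y z] by simp
    fix j i assume ji: "j \<in> {1..c}" "i \<in> indices d"
    show "\<bar>x j i - z j i\<bar> \<le> ?n x y + ?n y z"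
      using le[OF ji, of x y] le[OF ji, of y z] by linarith
  qed
qed

lemma mspace_ctensor_metric [simp]: "mspace (ctensor_metric c d) = ctensors c d"
  unfolding ctensor_metric_def by (rule Metric_space.mspace_metric[OF Metric_space_ctensors])

lemma mdist_ctensor_metric [simp]:
  "mdist (ctensor_metric c d) = (\<lambda>x y. sup_norm c d (\<lambda>j i. x j i - y j i))"
  unfolding ctensor_metric_def by (rule Metric_space.mdist_metric[OF Metric_space_ctensors])

end

(*
  Upper bound.  Call a tensor-valued map approximable at depth N if it is a uniform limit on K of
  one-channel networks of depth N.  Since the activation is continuous and not a polynomial, for
  every n some n-th forward difference of it does not vanish; differentiating under (averaged)
  activations then shows that convolving a pointwise product of maps approximable at depth N gives
  a map approximable at depth N + 1.  At depth n the shifts of the input by at most n are available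
  and, thanks to the zero padding, the indicators of the positions at distance less than n from the
  boundary.  With these one writes every monomial in the input entries, placed at a single output
  position, as a network of the minimal depth: the product is formed at a neighbouring position q of
  the last hidden layer, and it vanishes at all other relevant positions, because there either a
  boundary indicator vanishes or one factor of the monomial is shifted into the padding.  The
  Stone-Weierstrass theorem finishes the argument.

  Lower bound.  One layer is affine.  For maximal extent M >= 4, depth M - 2 does not let one corner
  see the opposite one.  For M = 3, moving an input entry together with the output position by one
  unit changes a depth-two network by an amount that does not depend on the value of the entry.
*)

theory Submission
  imports Defs
begin

section \<open>Continuous functions with vanishing differences\<close>

definition fdiff :: "real \<Rightarrow> (real \<Rightarrow> real) \<Rightarrow> real \<Rightarrow> real" where
  "fdiff h f x = f (x + h) - f x"

text \<open>Shifting by h is the identity plus \<open>fdiff h\<close>, so this is the binomial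
  expansion of its k-th power; the induction step is Pascal's rule.\<close>

lemma newton_forward:
  "f (x + real k * h) = (\<Sum>i\<le>k. real (k choose i) * (fdiff h ^^ i) f x)"
proof (induction k arbitrary: x)
  case 0
  then show ?case by simp
next
  case (Suc k)
  define a where "a i = (fdiff h ^^ i) f x" for i
  have a: "(fdiff h ^^ i) f (x + h) = a i + a (Suc i)" for i
    by (simp add: a_def fdiff_def)
  have "f (x + real (Suc k) * h) = f ((x + h) + real k * h)"
    by (simp add: algebra_simps)
  also have "\<dots> = (\<Sum>i\<le>k. real (k choose i) * (a i + a (Suc i)))"
    by (simp only: Suc.IH a)
  also have "\<dots> = (\<Sum>i\<le>k. real (k choose i) * a i) + (\<Sum>i\<le>k. real (k choose i) * a (Suc i))"
    by (simp add: distrib_left sum.distrib)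
  also have "(\<Sum>i\<le>k. real (k choose i) * a i) = (\<Sum>i\<le>Suc k. real (k choose i) * a i)"
    by simp
  also have "\<dots> = a 0 + (\<Sum>i\<le>k. real (k choose Suc i) * a (Suc i))"
    by (subst sum.atMost_Suc_shift) simp
  also have "\<dots> + (\<Sum>i\<le>k. real (k choose i) * a (Suc i))
      = a 0 + (\<Sum>i\<le>k. real (Suc k choose Suc i) * a (Suc i))"
    by (simp add: sum.distrib distrib_right)
  also have "\<dots> = (\<Sum>i\<le>Suc k. real (Suc k choose i) * a i)"
    by (subst sum.atMost_Suc_shift) simp
  finally show ?case by (simp add: a_def)
qed

lemma poly_eqI_naturals:
  fixes p q :: "real poly"
  assumes "\<And>k::nat. poly p (a + real k) = poly q (a + real k)"
  shows "p = q"
proof (rule ccontr)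
  assume "p \<noteq> q"
  then have "finite {x. poly (p - q) x = 0}"
    by (intro poly_roots_finite) simp
  moreover have "range (\<lambda>k. a + real k) \<subseteq> {x. poly (p - q) x = 0}"
    using assms by auto
  moreover have "infinite (range (\<lambda>k. a + real k))"
    by (intro range_inj_infinite) (auto simp: inj_def)
  ultimately show False
    using finite_subset by blast
qed

text \<open>Newton's series breaks off after n terms, and each binomial coefficient
  \<open>k choose i\<close> is a polynomial in k.\<close>

lemma fdiff_zero_imp_poly_progression:
  assumes "\<And>x. (fdiff h ^^ n) f x = 0"
  shows "\<exists>p. \<forall>k::nat. f (a + real k * h) = poly p (real k)"
proof -
  define b :: "nat \<Rightarrow> real poly" where
    "b i = smult (1 / fact i) (\<Prod>j = 0..<i. [:- real j, 1:])" for i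
  have b: "poly (b i) (real k) = real (k choose i)" for i k
    by (simp add: b_def poly_prod binomial_gbinomial gbinomial_prod_rev)
  have "(fdiff h ^^ (n + j)) f x = 0" for j x
    by (induction j arbitrary: x) (use assms in \<open>auto simp: fdiff_def\<close>)
  then have z: "(fdiff h ^^ i) f x = 0" if "i \<ge> n" for i x
    using that le_Suc_ex by blast
  have "f (a + real k * h) = poly (\<Sum>i<n. smult ((fdiff h ^^ i) f a) (b i)) (real k)" for k
  proof -
    have "f (a + real k * h) = (\<Sum>i\<le>k. real (k choose i) * (fdiff h ^^ i) f a)"
      by (rule newton_forward)
    \<comment> \<open>The union avoids comparing k with n: binomial coefficients vanish for i > k
      and differences for i \<ge> n, so either truncation may be used.\<close>
    also have "\<dots> = (\<Sum>i\<in>{..k} \<union> {..<n}. real (k choose i) * (fdiff h ^^ i) f a)"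
      by (intro sum.mono_neutral_left) auto
    also have "\<dots> = (\<Sum>i<n. real (k choose i) * (fdiff h ^^ i) f a)"
      by (intro sum.mono_neutral_right) (auto simp: z)
    finally show ?thesis
      by (simp add: poly_sum b mult.commute)
  qed
  then show ?thesis by blast
qed

text \<open>On the half-line starting at a, the grids of mesh 1/(m+1) give polynomials that agree at
  all points a + k and hence coincide. The common polynomial equals f at a + q for every rational q
  \<ge> 0, and by continuity on the whole half-line. Half-lines with different starting points
  overlap, so their polynomials coincide as well.\<close>

lemma fdiff_zero_imp_polynomial:
  assumes cont: "continuous_on UNIV f" and z: "\<And>h x. h > 0 \<Longrightarrow> (fdiff h ^^ n) f x = 0"
  shows "\<exists>p. \<forall>x. f x = poly p x"
proof -
  have "\<exists>p. \<forall>x\<ge>a. f x = poly p x" for a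
  proof -
    have "\<exists>p. \<forall>k::nat. f (a + real k * (1 / real (Suc m))) = poly p (real k)" for m
      by (rule fdiff_zero_imp_poly_progression[OF z]) simp
    then obtain P where P: "\<And>m k. f (a + real k * (1 / real (Suc m))) = poly (P m) (real k)"
      by metis
    \<comment> \<open>\<open>P m\<close> has the grid index as its variable; \<open>Q m\<close> is
      the same polynomial in the variable x, with index (x - a)(m + 1).\<close>
    define Q where "Q m = pcompose (P m) [:- a * real (Suc m), real (Suc m):]" for m
    have Q: "f (a + real k / real (Suc m)) = poly (Q m) (a + real k / real (Suc m))" for k m
    proof -
      have "- a * real (Suc m) + (a + real k / real (Suc m)) * real (Suc m) = real k"
        by (simp add: field_simps del: of_nat_Suc)
      then show ?thesis
        using P[of k m] by (simp add: Q_def poly_pcompose del: of_nat_Suc)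
    qed
    have QQ: "Q m = Q 0" for m
    proof (rule poly_eqI_naturals)
      fix k :: nat
      have "poly (Q m) (a + real k) = f (a + real k)"
        using Q[of "k * Suc m" m] by (simp only: of_nat_mult) simp
      then show "poly (Q m) (a + real k) = poly (Q 0) (a + real k)"
        using Q[of k 0] by simp
    qed
    have rat: "f (a + q) = poly (Q 0) (a + q)" if q: "q \<in> \<rat>" "q \<ge> 0" for q
    proof -
      obtain k m :: nat where km: "m \<noteq> 0" "\<bar>q\<bar> = real k / real m"
        using Rats_abs_nat_div_natE[OF q(1)] by blast
      then obtain m' where "m = Suc m'" by (metis not0_implies_Suc)
      then show ?thesis
        using km q Q[of k m'] QQ[of m'] by simp
    qed
    have "f x = poly (Q 0) x" if "x > a" for x
    proof -
      have "continuous_on (closure ((+) a ` \<rat> \<inter> {a<..})) (\<lambda>x. f x - poly (Q 0) x)"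
        by (intro continuous_intros continuous_on_subset[OF cont]) auto
      moreover have "f y - poly (Q 0) y = 0" if "y \<in> (+) a ` \<rat> \<inter> {a<..}" for y
        using that rat by auto
      moreover have "x \<in> closure ((+) a ` \<rat> \<inter> {a<..})"
      proof (subst closure_approachable, intro allI impI)
        fix e :: real assume "e > 0"
        then obtain q where "q \<in> \<rat>" "x - a < q" "q < x - a + e"
          using Rats_dense_in_real[of "x - a" "x - a + e"] by auto
        then show "\<exists>y\<in>(+) a ` \<rat> \<inter> {a<..}. dist y x < e"
          using that by (intro bexI[of _ "a + q"]) (auto simp: dist_real_def)
      qed
      ultimately have "f x - poly (Q 0) x = 0"
        using continuous_constant_on_closure[of "(+) a ` \<rat> \<inter> {a<..}" "\<lambda>x. f x - poly (Q 0) x" 0 x]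
        by blast
      then show ?thesis by simp
    qed
    moreover have "f a = poly (Q 0) a" using rat[of 0] by simp
    ultimately show ?thesis
      by (metis order_le_less)
  qed
  then obtain p where p: "\<And>a x. x \<ge> a \<Longrightarrow> f x = poly (p a) x" by metis
  have p0: "p a = p 0" for a
  proof (rule poly_eqI_naturals)
    fix k :: nat
    show "poly (p a) (max a 0 + real k) = poly (p 0) (max a 0 + real k)"
      using p[of a "max a 0 + real k"] p[of 0 "max a 0 + real k"] by simp
  qed
  have "f x = poly (p 0) x" for x
    using p[of x x] p0[of x] by simp
  then show ?thesis by blast
qed

section \<open>Products in the closed span of activations\<close>

lemma mvt_increment:
  fixes F g :: "real \<Rightarrow> real"
  assumes "\<And>x. (F has_real_derivative g x) (at x)"
  obtains \<xi> where "\<bar>\<xi> - y\<bar> \<le> \<bar>v\<bar>" "F (y + v) - F y = v * g \<xi>"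
proof (cases v "0 :: real" rule: linorder_cases)
  case less
  then obtain \<xi> where "y + v < \<xi>" "\<xi> < y" "F y - F (y + v) = (y - (y + v)) * g \<xi>"
    using MVT2[of "y + v" y F g] assms by auto
  then show ?thesis using less by (intro that[of \<xi>]) (auto simp: algebra_simps)
next
  case equal
  then show ?thesis by (intro that[of y]) auto
next
  case greater
  then obtain \<xi> where "y < \<xi>" "\<xi> < y + v" "F (y + v) - F y = (y + v - y) * g \<xi>"
    using MVT2[of y "y + v" F g] assms by auto
  then show ?thesis using greater by (intro that[of \<xi>]) (auto simp: algebra_simps)
qed

lemma modulus_on_interval:
  fixes f :: "real \<Rightarrow> real"
  assumes "continuous_on UNIV f" "e > 0"
  obtains \<delta> where "\<delta> > 0"
    "\<And>x y. \<lbrakk>\<bar>x\<bar> \<le> B; \<bar>y\<bar> \<le> B; \<bar>x - y\<bar> < \<delta>\<rbrakk> \<Longrightarrow> \<bar>f x - f y\<bar> < e"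
proof -
  have "uniformly_continuous_on {-B..B} f"
    by (rule compact_uniformly_continuous) (auto intro: continuous_on_subset[OF assms(1)])
  then obtain \<delta> where "\<delta> > 0" and
    \<delta>: "\<And>x y. \<lbrakk>x \<in> {-B..B}; y \<in> {-B..B}; dist y x < \<delta>\<rbrakk> \<Longrightarrow> dist (f y) (f x) < e"
    using assms(2) unfolding uniformly_continuous_on_def by metis
  show ?thesis
    by (rule that[OF \<open>\<delta> > 0\<close>]) (use \<delta> in \<open>auto simp: dist_real_def abs_le_iff\<close>)
qed

text \<open>Telescoping over n equal steps, with the mean value theorem on each; uniform continuity
  on [-B-h, B+h] bounds the error of a step by e/n. One n serves all y, so the integral of f over
  [y, y+h] is uniformly approximated by a fixed combination of translates of f.\<close>

lemma uniform_Riemann_sum: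
  fixes G f :: "real \<Rightarrow> real"
  assumes G: "\<And>x. (G has_real_derivative f x) (at x)" and f: "continuous_on UNIV f"
    and h: "h > 0" and e: "e > 0"
  obtains n where "n > 0"
    "\<And>y. \<bar>y\<bar> \<le> B \<Longrightarrow> \<bar>G (y + h) - G y - (\<Sum>k<n. h / real n * f (y + real k * (h / real n)))\<bar> \<le> e"
proof -
  obtain \<delta> where "\<delta> > 0" and
    \<delta>: "\<And>x y. \<lbrakk>\<bar>x\<bar> \<le> B + h; \<bar>y\<bar> \<le> B + h; \<bar>x - y\<bar> < \<delta>\<rbrakk> \<Longrightarrow> \<bar>f x - f y\<bar> < e / h"
    using modulus_on_interval[OF f, of "e / h" "B + h"] e h by (metis divide_pos_pos)
  obtain m :: nat where "h / \<delta> < real m" using reals_Archimedean2 by blast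
  then have m': "h < \<delta> * real m"
    using \<open>\<delta> > 0\<close> by (simp add: field_simps)
  with h have m: "m > 0" "h < \<delta> * real m"
    by (auto intro: gr0I)
  define s where "s = h / real m"
  have s: "s > 0" "s < \<delta>" "real m * s = h"
    using m h by (auto simp: s_def field_simps)
  show ?thesis
  proof (rule that[OF m(1)])
    fix y assume y: "\<bar>y\<bar> \<le> B"
    define g where "g k = G (y + real k * s)" for k
    have step: "\<bar>g (Suc k) - g k - s * f (y + real k * s)\<bar> \<le> s * (e / h)" if "k < m" for k
    proof -
      have ks: "0 \<le> real k * s" "real k * s + s \<le> h"
        using that s(1) mult_right_mono[of "real (Suc k)" "real m" s]
        unfolding s(3) by (auto simp: algebra_simps)
      obtain \<xi> where \<xi>: "y + real k * s < \<xi>" "\<xi> < y + real k * s + s"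
        "G (y + real k * s + s) - G (y + real k * s) = s * f \<xi>"
        using MVT2[of "y + real k * s" "y + real k * s + s" G f] G s(1) by auto
      have "\<bar>f \<xi> - f (y + real k * s)\<bar> \<le> e / h"
        by (rule less_imp_le, rule \<delta>) (use \<xi> ks y s in linarith)+
      moreover have "g (Suc k) - g k - s * f (y + real k * s) = s * (f \<xi> - f (y + real k * s))"
        using \<xi>(3) by (simp add: g_def algebra_simps)
      ultimately show ?thesis using s(1) by (simp add: abs_mult mult_left_mono del: times_divide_eq_right)
    qed
    have "G (y + h) - G y = g m - g 0" by (simp add: g_def s(3))
    also have "\<dots> = (\<Sum>k<m. g (Suc k) - g k)" by (rule sum_lessThan_telescope[symmetric])
    finally have "G (y + h) - G y - (\<Sum>k<m. s * f (y + real k * s))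
        = (\<Sum>k<m. g (Suc k) - g k - s * f (y + real k * s))"
      by (simp add: sum_subtractf)
    also have "\<bar>\<dots>\<bar> \<le> (\<Sum>k<m. s * (e / h))"
      by (rule order_trans[OF sum_abs sum_mono]) (use step in auto)
    also have "\<dots> = (real m * s) * (e / h)" by simp
    also have "\<dots> = e" unfolding s(3) using h by simp
    finally show "\<bar>G (y + h) - G y - (\<Sum>k<m. h / real m * f (y + real k * (h / real m)))\<bar> \<le> e"
      by (simp add: s_def)
  qed
qed

text \<open>By the mean value theorem the quotient is u times g at a point within t C of y, and g is
  uniformly continuous on [-B-C, B+C]. Uniformity in u matters because u will be the value of a
  varying inner function.\<close>

lemma uniform_difference_quotient:
  fixes F g :: "real \<Rightarrow> real"
  assumes F: "\<And>x. (F has_real_derivative g x) (at x)" and g: "continuous_on UNIV g"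
    and e: "e > 0" and C: "C > 0"
  obtains t where "t > 0"
    "\<And>y u. \<lbrakk>\<bar>y\<bar> \<le> B; \<bar>u\<bar> \<le> C\<rbrakk> \<Longrightarrow> \<bar>(F (y + t * u) - F y) / t - u * g y\<bar> \<le> e"
proof -
  obtain \<delta> where "\<delta> > 0" and
    \<delta>: "\<And>x y. \<lbrakk>\<bar>x\<bar> \<le> B + C; \<bar>y\<bar> \<le> B + C; \<bar>x - y\<bar> < \<delta>\<rbrakk> \<Longrightarrow> \<bar>g x - g y\<bar> < e / C"
    using modulus_on_interval[OF g, of "e / C" "B + C"] e C by (metis divide_pos_pos)
  \<comment> \<open>The bound 1 keeps y + t u in [-B-C, B+C]; the other bound gives t C \<le>
    \<delta>/2, below the modulus.\<close>
  define t where "t = min 1 (\<delta> / (2 * C))"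
  have t: "t > 0" "t \<le> 1" "t * C < \<delta>"
  proof -
    show "t > 0" "t \<le> 1" using \<open>\<delta> > 0\<close> C by (auto simp: t_def)
    have "t * C \<le> \<delta> / (2 * C) * C" using C by (intro mult_right_mono) (auto simp: t_def)
    also have "\<dots> < \<delta>" using C \<open>\<delta> > 0\<close> by simp
    finally show "t * C < \<delta>" .
  qed
  show ?thesis
  proof (rule that[OF t(1)])
    fix y u assume y: "\<bar>y\<bar> \<le> B" and u: "\<bar>u\<bar> \<le> C"
    obtain \<xi> where \<xi>: "\<bar>\<xi> - y\<bar> \<le> \<bar>t * u\<bar>" "F (y + t * u) - F y = t * u * g \<xi>"
      using mvt_increment[OF F, of y "t * u"] by metis
    have tu: "\<bar>t * u\<bar> \<le> t * C" using t u by (simp add: abs_mult)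
    moreover have "t * C \<le> C" using t C by simp
    ultimately have "\<bar>g \<xi> - g y\<bar> \<le> e / C"
      by (intro less_imp_le[OF \<delta>]) (use \<xi>(1) y t(3) C in linarith)+
    then have "\<bar>u\<bar> * \<bar>g \<xi> - g y\<bar> \<le> C * (e / C)"
      using u C by (intro mult_mono) auto
    moreover have "(F (y + t * u) - F y) / t - u * g y = u * (g \<xi> - g y)"
      using \<xi>(2) t(1) by (simp add: field_simps)
    ultimately show "\<bar>(F (y + t * u) - F y) / t - u * g y\<bar> \<le> e"
      using C by (simp add: abs_mult)
  qed
qed

lemma continuous_imp_antiderivative:
  fixes f :: "real \<Rightarrow> real"
  assumes "continuous_on UNIV f"
  shows "\<exists>G. \<forall>x. (G has_real_derivative f x) (at x)"
proof -
  have "\<exists>G. \<forall>x::real. - \<infinity> < x \<longrightarrow> x < \<infinity> \<longrightarrow> (G has_vector_derivative f x) (at x)"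
    by (rule einterval_antiderivative)
      (use assms in \<open>auto simp: continuous_on_eq_continuous_at\<close>)
  then show ?thesis
    by (simp add: has_real_derivative_iff_has_vector_derivative)
qed

text \<open>\<open>W\<close> stands for the functions available before the activation and
  \<open>V\<close> for those available after it, up to uniform limits on \<open>X\<close>. In the
  application the points of \<open>X\<close> are pairs of an input and a position, so that one
  activation acts at all positions at once.\<close>

locale activation_span =
  fixes X :: "'a set" and W V :: "('a \<Rightarrow> real) set" and \<sigma> :: "real \<Rightarrow> real"
  assumes W_add: "\<lbrakk>\<phi> \<in> W; \<psi> \<in> W\<rbrakk> \<Longrightarrow> (\<lambda>z. \<phi> z + \<psi> z) \<in> W"
    and W_scale: "\<phi> \<in> W \<Longrightarrow> (\<lambda>z. a * \<phi> z) \<in> W"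
    and W_const: "(\<lambda>_. a) \<in> W"
    and W_bounded: "\<phi> \<in> W \<Longrightarrow> \<exists>B. \<forall>z\<in>X. \<bar>\<phi> z\<bar> \<le> B"
    and V_add: "\<lbrakk>u \<in> V; v \<in> V\<rbrakk> \<Longrightarrow> (\<lambda>z. u z + v z) \<in> V"
    and V_scale: "u \<in> V \<Longrightarrow> (\<lambda>z. a * u z) \<in> V"
    and V_closed: "(\<And>e. e > 0 \<Longrightarrow> \<exists>v\<in>V. \<forall>z\<in>X. \<bar>v z - u z\<bar> \<le> e) \<Longrightarrow> u \<in> V"
    and V_activation: "\<psi> \<in> W \<Longrightarrow> (\<lambda>z. \<sigma> (\<psi> z)) \<in> V"
    and activation_continuous: "continuous_on UNIV \<sigma>"
begin

text \<open>The invariant of an induction in which f replaces \<sigma>: the product is carried as a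
  factor in front of f applied to an arbitrary inner function, and taking a difference of f pays for
  one more factor.\<close>

definition admissible :: "(real \<Rightarrow> real) \<Rightarrow> ('a \<Rightarrow> real) list \<Rightarrow> bool" where
  "admissible f \<phi>s \<longleftrightarrow> continuous_on UNIV f \<and> set \<phi>s \<subseteq> W \<and>
     (\<forall>\<psi>\<in>W. (\<lambda>z. (\<Prod>\<phi>\<leftarrow>\<phi>s. \<phi> z) * f (\<psi> z)) \<in> V)"

lemma V_zero: "(\<lambda>_. 0) \<in> V"
  using V_scale[OF V_activation[OF W_const], of 0] by simp

lemma V_sum: "(\<And>k. k < n \<Longrightarrow> u k \<in> V) \<Longrightarrow> (\<lambda>z. \<Sum>k<(n::nat). u k z) \<in> V"
  by (induction n) (auto simp: V_zero V_add)

lemma prod_bounded: "set \<phi>s \<subseteq> W \<Longrightarrow> \<exists>B>0. \<forall>z\<in>X. \<bar>\<Prod>\<phi>\<leftarrow>\<phi>s. \<phi> z\<bar> \<le> B"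
proof (induction \<phi>s)
  case Nil
  then show ?case by (auto intro: exI[of _ 1])
next
  case (Cons \<phi> \<phi>s)
  then obtain B where B: "B > 0" "\<And>z. z \<in> X \<Longrightarrow> \<bar>\<Prod>\<phi>\<leftarrow>\<phi>s. \<phi> z\<bar> \<le> B" by auto
  obtain C where C: "\<And>z. z \<in> X \<Longrightarrow> \<bar>\<phi> z\<bar> \<le> C" using Cons W_bounded[of \<phi>] by auto
  have "\<bar>\<phi> z * (\<Prod>\<phi>\<leftarrow>\<phi>s. \<phi> z)\<bar> \<le> (\<bar>C\<bar> + 1) * B" if "z \<in> X" for z
    unfolding abs_mult using B[of] C[of z] that by (intro mult_mono) auto
  then show ?case
    using B(1) by (intro exI[of _ "(\<bar>C\<bar> + 1) * B"]) auto
qed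

lemma V_closed_product:
  assumes \<phi>s: "set \<phi>s \<subseteq> W"
    and "\<And>e. e > 0 \<Longrightarrow> \<exists>v. (\<lambda>z. (\<Prod>\<phi>\<leftarrow>\<phi>s. \<phi> z) * v z) \<in> V \<and> (\<forall>z\<in>X. \<bar>v z - u z\<bar> \<le> e)"
  shows "(\<lambda>z. (\<Prod>\<phi>\<leftarrow>\<phi>s. \<phi> z) * u z) \<in> V"
proof (rule V_closed)
  fix e :: real assume "e > 0"
  obtain C where C: "C > 0" "\<And>z. z \<in> X \<Longrightarrow> \<bar>\<Prod>\<phi>\<leftarrow>\<phi>s. \<phi> z\<bar> \<le> C"
    using prod_bounded[OF \<phi>s] by auto
  then obtain v where v: "(\<lambda>z. (\<Prod>\<phi>\<leftarrow>\<phi>s. \<phi> z) * v z) \<in> V" "\<And>z. z \<in> X \<Longrightarrow> \<bar>v z - u z\<bar> \<le> e / C"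
    using assms(2)[of "e / C"] \<open>e > 0\<close> by auto
  have "\<bar>(\<Prod>\<phi>\<leftarrow>\<phi>s. \<phi> z) * v z - (\<Prod>\<phi>\<leftarrow>\<phi>s. \<phi> z) * u z\<bar> \<le> e" if "z \<in> X" for z
  proof -
    have "\<bar>(\<Prod>\<phi>\<leftarrow>\<phi>s. \<phi> z)\<bar> * \<bar>v z - u z\<bar> \<le> C * (e / C)"
      using C v(2) that by (intro mult_mono) auto
    then show ?thesis using C(1) by (simp add: abs_mult flip: right_diff_distrib)
  qed
  then show "\<exists>v\<in>V. \<forall>z\<in>X. \<bar>v z - (\<Prod>\<phi>\<leftarrow>\<phi>s. \<phi> z) * u z\<bar> \<le> e"
    by (intro bexI[OF _ v(1)] ballI)
qed

text \<open>The difference of G is the integral of f over an interval of length h. It is a uniform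
  limit of Riemann sums, whose terms are translates of f, and translating means adding a constant to
  the inner function. The gain is differentiability.\<close>

lemma admissible_integral:
  assumes admissible: "admissible f \<phi>s" and G: "\<And>x. (G has_real_derivative f x) (at x)" and h: "h > 0"
  shows "admissible (\<lambda>y. G (y + h) - G y) \<phi>s"
proof -
  have f: "continuous_on UNIV f" and \<phi>s: "set \<phi>s \<subseteq> W"
    and V: "\<And>\<psi>. \<psi> \<in> W \<Longrightarrow> (\<lambda>z. (\<Prod>\<phi>\<leftarrow>\<phi>s. \<phi> z) * f (\<psi> z)) \<in> V"
    using admissible by (auto simp: admissible_def)
  have contG: "continuous_on UNIV G"
    using G by (meson DERIV_isCont continuous_at_imp_continuous_on)
  then have "continuous_on UNIV (\<lambda>y. G (y + h) - G y)"
    by (intro continuous_on_diff continuous_on_compose2[OF contG] continuous_on_add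
        continuous_on_id continuous_on_const) auto
  moreover have "(\<lambda>z. (\<Prod>\<phi>\<leftarrow>\<phi>s. \<phi> z) * (G (\<psi> z + h) - G (\<psi> z))) \<in> V" if \<psi>: "\<psi> \<in> W" for \<psi>
  proof (rule V_closed_product[OF \<phi>s])
    fix e :: real assume "e > 0"
    obtain B where B: "\<And>z. z \<in> X \<Longrightarrow> \<bar>\<psi> z\<bar> \<le> B" using W_bounded[OF \<psi>] by blast
    obtain n where n: "n > 0" "\<And>y. \<bar>y\<bar> \<le> B \<Longrightarrow>
        \<bar>G (y + h) - G y - (\<Sum>k<n. h / real n * f (y + real k * (h / real n)))\<bar> \<le> e"
      using uniform_Riemann_sum[OF G f h \<open>e > 0\<close>, of B] by blast
    let ?v = "\<lambda>z. \<Sum>k<n. h / real n * f (\<psi> z + real k * (h / real n))"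
    have "(\<lambda>z. \<Sum>k<n. h / real n * ((\<Prod>\<phi>\<leftarrow>\<phi>s. \<phi> z) * f (\<psi> z + real k * (h / real n)))) \<in> V"
      by (intro V_sum V_scale V W_add \<psi> W_const)
    then have "(\<lambda>z. (\<Prod>\<phi>\<leftarrow>\<phi>s. \<phi> z) * ?v z) \<in> V"
      by (simp add: sum_distrib_left mult.left_commute)
    moreover have "\<forall>z\<in>X. \<bar>?v z - (G (\<psi> z + h) - G (\<psi> z))\<bar> \<le> e"
      using n(2) B by (subst abs_minus_commute) blast
    ultimately show "\<exists>v. (\<lambda>z. (\<Prod>\<phi>\<leftarrow>\<phi>s. \<phi> z) * v z) \<in> V \<and>
        (\<forall>z\<in>X. \<bar>v z - (G (\<psi> z + h) - G (\<psi> z))\<bar> \<le> e)"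
      by (intro exI[of _ ?v] conjI)
  qed
  ultimately show ?thesis using \<phi>s by (simp add: admissible_def)
qed

text \<open>The difference quotient of F between \<psi> and \<psi> + t \<phi> is a combination of
  admissible terms, and as t tends to 0 the chain rule produces the new factor \<phi>.\<close>

lemma admissible_derivative:
  assumes admissible: "admissible F \<phi>s" and F: "\<And>x. (F has_real_derivative g x) (at x)"
    and g: "continuous_on UNIV g" and \<phi>: "\<phi> \<in> W"
  shows "admissible g (\<phi> # \<phi>s)"
proof -
  have \<phi>s: "set \<phi>s \<subseteq> W"
    and V: "\<And>\<psi>. \<psi> \<in> W \<Longrightarrow> (\<lambda>z. (\<Prod>\<phi>\<leftarrow>\<phi>s. \<phi> z) * F (\<psi> z)) \<in> V"
    using admissible by (auto simp: admissible_def)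
  have "(\<lambda>z. (\<Prod>\<phi>\<leftarrow>\<phi>s. \<phi> z) * (\<phi> z * g (\<psi> z))) \<in> V" if \<psi>: "\<psi> \<in> W" for \<psi>
  proof (rule V_closed_product[OF \<phi>s])
    fix e :: real assume "e > 0"
    obtain B where B: "\<And>z. z \<in> X \<Longrightarrow> \<bar>\<psi> z\<bar> \<le> B" using W_bounded[OF \<psi>] by blast
    obtain C where C: "C > 0" "\<And>z. z \<in> X \<Longrightarrow> \<bar>\<phi> z\<bar> \<le> C"
      using prod_bounded[of "[\<phi>]"] \<phi> by auto
    obtain t where t: "t > 0" "\<And>y u. \<lbrakk>\<bar>y\<bar> \<le> B; \<bar>u\<bar> \<le> C\<rbrakk> \<Longrightarrow> \<bar>(F (y + t * u) - F y) / t - u * g y\<bar> \<le> e"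
      using uniform_difference_quotient[OF F g \<open>e > 0\<close> C(1), of B] by blast
    let ?v = "\<lambda>z. (F (\<psi> z + t * \<phi> z) - F (\<psi> z)) / t"
    have "(\<lambda>z. 1 / t * ((\<Prod>\<phi>\<leftarrow>\<phi>s. \<phi> z) * F (\<psi> z + t * \<phi> z)) + (- 1 / t) * ((\<Prod>\<phi>\<leftarrow>\<phi>s. \<phi> z) * F (\<psi> z))) \<in> V"
      by (intro V_add V_scale V W_add W_scale \<psi> \<phi>)
    also have "(\<lambda>z. 1 / t * ((\<Prod>\<phi>\<leftarrow>\<phi>s. \<phi> z) * F (\<psi> z + t * \<phi> z)) + (- 1 / t) * ((\<Prod>\<phi>\<leftarrow>\<phi>s. \<phi> z) * F (\<psi> z)))
        = (\<lambda>z. (\<Prod>\<phi>\<leftarrow>\<phi>s. \<phi> z) * ?v z)"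
      using t(1) by (simp add: field_simps)
    finally have "(\<lambda>z. (\<Prod>\<phi>\<leftarrow>\<phi>s. \<phi> z) * ?v z) \<in> V" .
    then show "\<exists>v. (\<lambda>z. (\<Prod>\<phi>\<leftarrow>\<phi>s. \<phi> z) * v z) \<in> V \<and> (\<forall>z\<in>X. \<bar>v z - \<phi> z * g (\<psi> z)\<bar> \<le> e)"
      using t(2) B C(2) by (intro exI[of _ ?v]) auto
  qed
  then show ?thesis using \<phi>s \<phi> g by (simp add: admissible_def mult_ac)
qed

text \<open>The average of \<open>f\<close> over intervals of length \<open>h\<close> is differentiable with derivative
  proportional to \<open>fdiff h f\<close>, and differentiating it at \<open>\<psi> + t * \<phi>\<close> in \<open>t\<close> splits off the factor \<open>\<phi>\<close>.\<close>

lemma admissible_fdiff: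
  assumes admissible: "admissible f \<phi>s" and h: "h > 0" and \<phi>: "\<phi> \<in> W"
  shows "admissible (fdiff h f) (\<phi> # \<phi>s)"
proof -
  have f: "continuous_on UNIV f" using admissible by (simp add: admissible_def)
  obtain G where G: "\<And>x. (G has_real_derivative f x) (at x)"
    using continuous_imp_antiderivative[OF f] by blast
  have "((\<lambda>y. G (y + h) - G y) has_real_derivative fdiff h f x) (at x)" for x
    unfolding fdiff_def using G
    by (intro DERIV_diff) (simp_all flip: DERIV_shift)
  moreover have "continuous_on UNIV (fdiff h f)"
    unfolding fdiff_def by (intro continuous_intros continuous_on_compose2[OF f]) (auto intro: f)
  ultimately show ?thesis
    using admissible_derivative[OF admissible_integral[OF admissible G h] _ _ \<phi>] by simp
qed

lemma admissible_fdiff_power: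
  "\<lbrakk>set \<phi>s \<subseteq> W; h > 0\<rbrakk> \<Longrightarrow> admissible ((fdiff h ^^ length \<phi>s) \<sigma>) \<phi>s"
proof (induction \<phi>s)
  case Nil
  then show ?case using V_activation activation_continuous by (simp add: admissible_def)
qed (simp add: admissible_fdiff)

theorem product_in_V:
  assumes nonpoly: "\<not> (\<exists>p. \<forall>x. \<sigma> x = poly p x)" and \<phi>s: "set \<phi>s \<subseteq> W"
  shows "(\<lambda>z. \<Prod>\<phi>\<leftarrow>\<phi>s. \<phi> z) \<in> V"
proof -
  \<comment> \<open>If all these differences vanished, \<sigma> would be a polynomial. The constant
    inner function \<theta> then turns the remaining factor into a nonzero number that can be
    divided out.\<close>
  obtain h \<theta> where h: "h > 0" and ne: "(fdiff h ^^ length \<phi>s) \<sigma> \<theta> \<noteq> 0"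
    using fdiff_zero_imp_polynomial[OF activation_continuous] nonpoly by blast
  have "(\<lambda>z. (\<Prod>\<phi>\<leftarrow>\<phi>s. \<phi> z) * (fdiff h ^^ length \<phi>s) \<sigma> \<theta>) \<in> V"
    using admissible_fdiff_power[OF \<phi>s h, unfolded admissible_def] W_const[of \<theta>] by (auto dest: bspec)
  from V_scale[OF this, of "1 / (fdiff h ^^ length \<phi>s) \<sigma> \<theta>"] ne show ?thesis by simp
qed

end

section \<open>Parallel composition and continuity of networks\<close>

lemma sum_1_add:
  fixes f :: "nat \<Rightarrow> 'a::comm_monoid_add"
  shows "(\<Sum>j = 1..m + n. f j) = (\<Sum>j = 1..m. f j) + (\<Sum>j = 1..n. f (m + j))"
  by (induction n) (simp_all add: add.assoc)

lemma conv_zero [simp]: "conv d k (\<lambda>_. 0) x p = 0"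
  by (simp add: conv_def)

lemma conv_sum_kernel:
  "conv d k (\<lambda>q. \<Sum>j\<in>J. a j * w j q) x p = (\<Sum>j\<in>J. a j * conv d k (w j) x p)"
proof (cases "p \<in> indices d")
  case True
  have "(\<Sum>q\<in>kernel_range k. (\<Sum>j\<in>J. a j * w j q) * x (p - q))
      = (\<Sum>q\<in>kernel_range k. \<Sum>j\<in>J. a j * w j q * x (p - q))"
    by (simp add: sum_distrib_right)
  also have "\<dots> = (\<Sum>j\<in>J. \<Sum>q\<in>kernel_range k. a j * w j q * x (p - q))"
    by (rule sum.swap)
  also have "\<dots> = (\<Sum>j\<in>J. a j * (\<Sum>q\<in>kernel_range k. w j q * x (p - q)))"
    by (simp add: sum_distrib_left mult.assoc)
  finally show ?thesis using True by (simp add: conv_def)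
qed (simp add: conv_def)

lemma conv_layer_post:
  "(\<lambda>i p. if i \<in> {1..m'} then (\<Sum>j = 1..m. a i j * conv_layer d k c1 m w \<delta> y j p) + b i * ones d p else 0)
   = conv_layer d k c1 m' (\<lambda>i l q. \<Sum>j = 1..m. a i j * w j l q) (\<lambda>i. (\<Sum>j = 1..m. a i j * \<delta> j) + b i) y"
proof (intro ext)
  fix i p
  have "(\<Sum>j = 1..m. a i j * conv_layer d k c1 m w \<delta> y j p)
      = (\<Sum>j = 1..m. a i j * (\<Sum>l = 1..c1. conv d k (w j l) (y l) p)) + (\<Sum>j = 1..m. a i j * \<delta> j) * ones d p"
    by (simp add: conv_layer_def distrib_left sum.distrib sum_distrib_right mult.assoc)
  also have "(\<Sum>j = 1..m. a i j * (\<Sum>l = 1..c1. conv d k (w j l) (y l) p))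
      = (\<Sum>l = 1..c1. conv d k (\<lambda>q. \<Sum>j = 1..m. a i j * w j l q) (y l) p)"
    unfolding conv_sum_kernel by (simp only: sum_distrib_left) (rule sum.swap)
  finally show "(if i \<in> {1..m'} then (\<Sum>j = 1..m. a i j * conv_layer d k c1 m w \<delta> y j p) + b i * ones d p else 0)
    = conv_layer d k c1 m' (\<lambda>i l q. \<Sum>j = 1..m. a i j * w j l q) (\<lambda>i. (\<Sum>j = 1..m. a i j * \<delta> j) + b i) y i p"
    by (simp add: conv_layer_def distrib_right)
qed

lemma is_cnn_pos: "is_cnn \<sigma> d k c N m f \<Longrightarrow> N \<ge> 1"
  by (induction rule: is_cnn.induct) auto

lemma is_cnn_1_iff: "is_cnn \<sigma> d k c (Suc 0) m f \<longleftrightarrow> f \<in> conv_layers d k c m"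
proof
  assume "is_cnn \<sigma> d k c (Suc 0) m f"
  then show "f \<in> conv_layers d k c m"
    by cases (auto dest: is_cnn_pos)
qed (rule is_cnn.single[unfolded One_nat_def])

text \<open>An affine recombination of channels merges into the kernels and biases of the last
  layer, so it costs no depth.\<close>

lemma is_cnn_post:
  assumes "is_cnn \<sigma> d k c N m f"
  shows "is_cnn \<sigma> d k c N m'
    (\<lambda>x i p. if i \<in> {1..m'} then (\<Sum>j = 1..m. a i j * f x j p) + b i * ones d p else 0)"
  using assms
proof cases
  case single
  then obtain w \<delta> where "f = conv_layer d k c m w \<delta>" by (auto simp: conv_layers_def)
  then have "(\<lambda>x i p. if i \<in> {1..m'} then (\<Sum>j = 1..m. a i j * f x j p) + b i * ones d p else 0)
      \<in> conv_layers d k c m'"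
    by (auto simp only: conv_layers_def conv_layer_post)
  then show ?thesis
    unfolding \<open>N = 1\<close> by (rule is_cnn.single)
next
  case (layer N' l g C)
  then obtain w \<delta> where C: "C = conv_layer d k l m w \<delta>" by (auto simp: conv_layers_def)
  let ?C = "conv_layer d k l m' (\<lambda>i l q. \<Sum>j = 1..m. a i j * w j l q) (\<lambda>i. (\<Sum>j = 1..m. a i j * \<delta> j) + b i)"
  have "is_cnn \<sigma> d k c (Suc N') m' (?C \<circ> activate \<sigma> l d \<circ> g)"
    using layer by (intro is_cnn.layer) (auto simp: conv_layers_def)
  then show ?thesis
    unfolding layer(1,2) C comp_def conv_layer_post .
qed

text \<open>Equal depth lets both networks run side by side: the first layer reads the common input,
  channels are concatenated in every layer, and from the second layer on the kernels between the two
  blocks are zero.\<close>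

lemma is_cnn_pair:
  assumes "is_cnn \<sigma> d k c N a f" "is_cnn \<sigma> d k c N b g"
  shows "\<exists>h. is_cnn \<sigma> d k c N (a + b) h \<and>
    (\<forall>x. (\<forall>j\<in>{1..a}. h x j = f x j) \<and> (\<forall>j\<in>{1..b}. h x (a + j) = g x j))"
  using assms
proof (induction arbitrary: b g rule: is_cnn.induct)
  case (single C c')
  then obtain w1 \<delta>1 w2 \<delta>2 where C: "C = conv_layer d k c c' w1 \<delta>1" "g = conv_layer d k c b w2 \<delta>2"
    unfolding One_nat_def is_cnn_1_iff by (auto simp: conv_layers_def)
  let ?h = "conv_layer d k c (c' + b) (\<lambda>i. if i \<le> c' then w1 i else w2 (i - c'))
    (\<lambda>i. if i \<le> c' then \<delta>1 i else \<delta>2 (i - c'))"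
  have "is_cnn \<sigma> d k c 1 (c' + b) ?h"
    by (intro is_cnn.single) (auto simp: conv_layers_def)
  moreover have "\<forall>x. (\<forall>j\<in>{1..c'}. ?h x j = C x j) \<and> (\<forall>j\<in>{1..b}. ?h x (c' + j) = g x j)"
    by (auto simp: C conv_layer_def)
  ultimately show ?case by blast
next
  case (layer N m f C c')
  from layer.prems obtain m2 f2 C2 where g: "g = C2 \<circ> activate \<sigma> m2 d \<circ> f2"
    "is_cnn \<sigma> d k c N m2 f2" "m2 \<ge> 1" "C2 \<in> conv_layers d k m2 b"
    by cases (use is_cnn_pos[OF layer.hyps(1)] in auto)
  obtain h where h: "is_cnn \<sigma> d k c N (m + m2) h"
    "\<And>x j. j \<in> {1..m} \<Longrightarrow> h x j = f x j" "\<And>x j. j \<in> {1..m2} \<Longrightarrow> h x (m + j) = f2 x j"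
    using layer.IH[OF g(2)] by blast
  obtain w1 \<delta>1 w2 \<delta>2 where C: "C = conv_layer d k m c' w1 \<delta>1" "C2 = conv_layer d k m2 b w2 \<delta>2"
    using layer.hyps g(4) by (auto simp: conv_layers_def)
  define H where "H = conv_layer d k (m + m2) (c' + b)
    (\<lambda>i j. if i \<le> c' then if j \<le> m then w1 i j else (\<lambda>_. 0)
           else if j \<le> m then (\<lambda>_. 0) else w2 (i - c') (j - m))
    (\<lambda>i. if i \<le> c' then \<delta>1 i else \<delta>2 (i - c'))"
  have "is_cnn \<sigma> d k c (Suc N) (c' + b) (H \<circ> activate \<sigma> (m + m2) d \<circ> h)"
    using h(1) layer.hyps(2) by (intro is_cnn.layer) (auto simp: H_def conv_layers_def)
  moreover have act: "activate \<sigma> (m + m2) d (h x) j = activate \<sigma> m d (f x) j" if "j \<in> {1..m}" for x j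
    using that h(2)[OF that] by (auto simp: activate_def)
  moreover have act2: "activate \<sigma> (m + m2) d (h x) (m + j) = activate \<sigma> m2 d (f2 x) j"
    if "j \<in> {1..m2}" for x j
    using that h(3)[OF that] by (auto simp: activate_def)
  have "(H \<circ> activate \<sigma> (m + m2) d \<circ> h) x j = (C \<circ> activate \<sigma> m d \<circ> f) x j"
    if "j \<in> {1..c'}" for x j
  proof
    fix p
    have "(\<Sum>l = 1..m. conv d k (w1 j l) (activate \<sigma> (m + m2) d (h x) l) p)
        = (\<Sum>l = 1..m. conv d k (w1 j l) (activate \<sigma> m d (f x) l) p)"
      by (intro sum.cong refl) (simp only: act)
    then show "(H \<circ> activate \<sigma> (m + m2) d \<circ> h) x j p = (C \<circ> activate \<sigma> m d \<circ> f) x j p"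
      using that by (simp add: H_def C conv_layer_def sum_1_add[unfolded One_nat_def])
  qed
  moreover have "(H \<circ> activate \<sigma> (m + m2) d \<circ> h) x (c' + j) = g x j"
    if "j \<in> {1..b}" for x j
  proof
    fix p
    have "(\<Sum>l = 1..m2. conv d k (w2 j l) (activate \<sigma> (m + m2) d (h x) (m + l)) p)
        = (\<Sum>l = 1..m2. conv d k (w2 j l) (activate \<sigma> m2 d (f2 x) l) p)"
      by (intro sum.cong refl) (simp only: act2)
    then show "(H \<circ> activate \<sigma> (m + m2) d \<circ> h) x (c' + j) p = g x j p"
      using that by (simp add: H_def C g(1) conv_layer_def sum_1_add[unfolded One_nat_def])
  qed
  ultimately show ?case by blast
qed

lemma is_cnn_stack:
  assumes "n \<ge> 1" "\<And>j. j \<in> {1..n} \<Longrightarrow> is_cnn \<sigma> d k c N 1 (f j)"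
  shows "\<exists>h. is_cnn \<sigma> d k c N n h \<and> (\<forall>x. \<forall>j\<in>{1..n}. h x j = f j x 1)"
  using assms
proof (induction n rule: nat_induct_at_least)
  case base
  then show ?case by (intro exI[of _ "f 1"]) auto
next
  case (Suc n)
  then obtain h where h: "is_cnn \<sigma> d k c N n h" "\<And>x j. j \<in> {1..n} \<Longrightarrow> h x j = f j x 1"
    by auto
  obtain h' where h': "is_cnn \<sigma> d k c N (n + 1) h'"
    "\<And>x j. j \<in> {1..n} \<Longrightarrow> h' x j = h x j" "\<And>x j. j \<in> {1..1} \<Longrightarrow> h' x (n + j) = f (Suc n) x j"
    using is_cnn_pair[OF h(1) Suc.prems[of "Suc n"]] by auto
  have "h' x j = f j x 1" if "j \<in> {1..Suc n}" for x j
    using h(2) h'(2) h'(3)[of 1] that by (cases "j = Suc n") auto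
  then show ?case using h'(1) by auto
qed

lemma is_cnn_exists: "N \<ge> 1 \<Longrightarrow> \<exists>f. is_cnn \<sigma> d k c N m f"
proof (induction N arbitrary: m rule: nat_induct_at_least)
  case base
  have "conv_layer d k c m undefined undefined \<in> conv_layers d k c m"
    by (auto simp: conv_layers_def)
  then show ?case by (blast intro: is_cnn.single)
next
  case (Suc N)
  obtain f where "is_cnn \<sigma> d k c N 1 f" using Suc.IH by blast
  moreover have "conv_layer d k 1 m undefined undefined \<in> conv_layers d k 1 m"
    by (auto simp: conv_layers_def)
  ultimately show ?case by (blast intro: is_cnn.layer)
qed

lemma conv_layers_ctensors: "f \<in> conv_layers d k c m \<Longrightarrow> f x \<in> ctensors m d"
  by (auto simp: conv_layers_def conv_layer_def ctensors_def conv_def ones_def)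

lemma is_cnn_ctensors: "is_cnn \<sigma> d k c N m f \<Longrightarrow> f x \<in> ctensors m d"
  by (cases rule: is_cnn.cases) (auto simp: conv_layers_ctensors)

section \<open>Continuity of networks and the product topology on tensors\<close>

lemma continuous_on_coordinate:
  "continuous_on S (\<lambda>x :: 'n::finite ctensor. x j i)"
  by (rule continuous_on_product_then_coordinatewise[OF continuous_on_product_then_coordinatewise])
    (rule continuous_on_id)

lemma continuous_on_ctensorI:
  fixes f :: "'a::topological_space \<Rightarrow> 'n::finite ctensor"
  assumes "\<And>j i. continuous_on S (\<lambda>x. f x j i)"
  shows "continuous_on S f"
  using assms by (intro continuous_on_coordinatewise_then_product)

lemma continuous_on_conv_layer:
  assumes "C \<in> conv_layers d k c m"
  shows "continuous_on S C"
proof -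
  obtain w \<delta> where C: "C = conv_layer d k c m w \<delta>" using assms by (auto simp: conv_layers_def)
  show ?thesis
  proof (rule continuous_on_ctensorI)
    fix j i
    show "continuous_on S (\<lambda>x. C x j i)"
    proof (cases "j \<in> {1..m} \<and> i \<in> indices d")
      case True
      then show ?thesis
        by (simp add: C conv_layer_def conv_def)
          (intro continuous_on_add continuous_on_sum continuous_on_mult continuous_on_const
            continuous_on_coordinate)
    next
      case False
      then have "(\<lambda>x. C x j i) = (\<lambda>_. 0)"
        by (auto simp: fun_eq_iff C conv_layer_def conv_def ones_def)
      then show ?thesis by (simp only: continuous_on_const)
    qed
  qed
qed

lemma continuous_on_activate:
  assumes "continuous_on UNIV \<sigma>"
  shows "continuous_on S (activate \<sigma> m d)"
proof (rule continuous_on_ctensorI)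
  fix j i
  show "continuous_on S (\<lambda>x. activate \<sigma> m d x j i)"
    by (cases "j \<in> {1..m} \<and> i \<in> indices d")
      (auto simp: activate_def intro!: continuous_on_coordinate continuous_on_compose2[OF assms])
qed

lemma continuous_on_cnn:
  assumes "is_cnn \<sigma> d k c N m f" "continuous_on UNIV \<sigma>"
  shows "continuous_on S f"
  using assms(1)
proof (induction arbitrary: S rule: is_cnn.induct)
  case (single C c')
  then show ?case by (rule continuous_on_conv_layer)
next
  case (layer N m f C c')
  then show ?case
    by (intro continuous_on_compose continuous_on_conv_layer[OF layer.hyps(3)]
        continuous_on_activate[OF assms(2)])
qed

text \<open>Only finitely many entries can be nonzero on \<open>ctensors c d\<close>, so sup-norm
  balls and product neighbourhoods contain one another. Continuity and compactness can then be
  treated in the topology of the function type.\<close>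

lemma ctensor_topology_eq:
  "ctensor_topology c d = top_of_set (ctensors c d)"
proof -
  interpret Metric_space "ctensors c d" "\<lambda>x y. sup_norm c d (\<lambda>j i. x j i - y j i)"
    by (rule Metric_space_ctensors)
  have top: "ctensor_topology c d = mtopology"
    by (simp add: ctensor_metric_def mtopology_of_def)
  have "continuous_map (top_of_set (ctensors c d)) mtopology (\<lambda>x. x)"
    unfolding continuous_map_to_metric
  proof (intro ballI allI impI)
    fix x and e :: real
    assume x: "x \<in> topspace (top_of_set (ctensors c d))" and e: "e > 0"
    let ?U = "ctensors c d \<inter> (\<Inter>(j, i)\<in>{1..c} \<times> indices d. {y. \<bar>y j i - x j i\<bar> < e / 2})"
    have "open {y :: 'a ctensor. \<bar>y j i - x j i\<bar> < e / 2}" for j i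
      by (intro open_Collect_less continuous_on_rabs continuous_on_diff continuous_on_const
          continuous_on_coordinate)
    then have "open (\<Inter>(j, i)\<in>{1..c} \<times> indices d. {y :: 'a ctensor. \<bar>y j i - x j i\<bar> < e / 2})"
      by (intro open_INT) auto
    then have "openin (top_of_set (ctensors c d)) ?U"
      by (rule openin_open_Int)
    moreover have "x \<in> ?U" using x e by auto
    moreover have "y \<in> mball x e" if "y \<in> ?U" for y
    proof -
      have "sup_norm c d (\<lambda>j i. x j i - y j i) \<le> e / 2"
        unfolding sup_norm_le_iff using that e by (auto simp: abs_minus_commute intro: less_imp_le)
      then show ?thesis using x that e by (auto simp: in_mball)
    qed
    ultimately show "\<exists>U. openin (top_of_set (ctensors c d)) U \<and> x \<in> U \<and> (\<forall>y\<in>U. y \<in> mball x e)"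
      by blast
  qed
  moreover have "continuous_map mtopology (top_of_set (ctensors c d)) (\<lambda>x. x)"
  proof -
    have "continuous_map mtopology euclideanreal (\<lambda>x. x j i)" for j i
    proof (cases "j \<in> {1..c} \<and> i \<in> indices d")
      case True
      have "\<bar>x j i - y j i\<bar> \<le> sup_norm c d (\<lambda>j i. x j i - y j i)" for x y :: "'a ctensor"
        using sup_norm_le_iff[of c d "\<lambda>j i. x j i - y j i" "sup_norm c d (\<lambda>j i. x j i - y j i)"] True
        by auto
      then show ?thesis
        unfolding continuous_map_from_metric
      proof (intro conjI ballI allI impI)
        fix a :: "'a ctensor" and U
        assume le: "\<And>x y. \<bar>x j i - y j i\<bar> \<le> sup_norm c d (\<lambda>j i. x j i - y j i :: real)"
          and U: "openin euclideanreal U \<and> a j i \<in> U"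
        then obtain e where "e > 0" and e: "\<And>t. \<bar>t - a j i\<bar> < e \<Longrightarrow> t \<in> U"
          unfolding open_openin[symmetric] open_dist dist_real_def by blast
        have "x j i \<in> U" if "sup_norm c d (\<lambda>j i. a j i - x j i) < e" for x
          by (rule e) (use le[of a x] that in linarith)
        then show "\<exists>r>0. \<forall>x. x \<in> ctensors c d \<and> sup_norm c d (\<lambda>j i. a j i - x j i) < r \<longrightarrow> x j i \<in> U"
          using \<open>e > 0\<close> by blast
      qed auto
    next
      case False
      then have "x j i = 0" if "x \<in> topspace mtopology" for x
        using that unfolding topspace_mtopology by (auto simp: ctensors_def)
      then show ?thesis
        using continuous_map_eq[of mtopology euclideanreal "\<lambda>_. 0" "\<lambda>x. x j i"] by simp
    qed
    then have "continuous_map mtopology euclidean (\<lambda>x. x)"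
      by (auto simp: continuous_map_componentwise_UNIV simp flip: euclidean_product_topology)
    then show ?thesis by (auto simp: continuous_map_in_subtopology)
  qed
  ultimately have "homeomorphic_maps mtopology (top_of_set (ctensors c d)) (\<lambda>x. x) (\<lambda>x. x)"
    by (auto simp: homeomorphic_maps_def)
  then show ?thesis
    unfolding top using homeomorphic_maps_id[of mtopology "top_of_set (ctensors c d)"]
    by (simp add: id_def)
qed

section \<open>Approximable maps\<close>

text \<open>Restores the zero padding before a convolution, because maps in \<open>approx\<close>
  are controlled on \<open>indices d\<close> only.\<close>

definition mask :: "nat ^ 'n \<Rightarrow> 'n tensor \<Rightarrow> 'n tensor" where
  "mask d u = (\<lambda>i. if i \<in> indices d then u i else 0)"

lemma conv_mask_diff_le:
  assumes "\<And>i. i \<in> indices d \<Longrightarrow> \<bar>u i - v i\<bar> \<le> e" "e \<ge> 0"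
  shows "\<bar>conv d k w (mask d u) p - conv d k w (mask d v) p\<bar> \<le> (\<Sum>j\<in>kernel_range k. \<bar>w j\<bar>) * e"
proof (cases "p \<in> indices d")
  case True
  have "conv d k w (mask d u) p - conv d k w (mask d v) p
      = (\<Sum>j\<in>kernel_range k. w j * (mask d u (p - j) - mask d v (p - j)))"
    using True by (simp add: conv_def right_diff_distrib sum_subtractf)
  also have "\<bar>\<dots>\<bar> \<le> (\<Sum>j\<in>kernel_range k. \<bar>w j\<bar> * e)"
    using assms by (intro order_trans[OF sum_abs] sum_mono) (auto simp: mask_def abs_mult intro!: mult_left_mono)
  finally show ?thesis by (simp add: sum_distrib_right)
qed (use assms in \<open>simp add: conv_def sum_nonneg\<close>)

lemma conv_linear:
  "conv d k w (\<lambda>i. a * u i + b * v i) p = a * conv d k w u p + b * conv d k w v p"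
  by (simp add: conv_def distrib_left sum.distrib sum_distrib_left mult_ac)

locale cnn_approximation =
  fixes \<sigma> :: "real \<Rightarrow> real" and d k :: "nat ^ 'n" and c :: nat and K :: "'n ctensor set"
  assumes cont: "continuous_on UNIV \<sigma>" and compact: "compact K"
begin

text \<open>One output channel suffices thanks to \<open>is_cnn_stack\<close>. Positions outside the
  index range are ignored, so \<phi> may be a formula, such as a shift, that is not padded
  itself.\<close>

definition approx :: "nat \<Rightarrow> ('n ctensor \<Rightarrow> 'n tensor) \<Rightarrow> bool" where
  "approx N \<phi> \<longleftrightarrow> (\<forall>e>0. \<exists>f. is_cnn \<sigma> d k c N 1 f \<and>
     (\<forall>x\<in>K. \<forall>i\<in>indices d. \<bar>f x 1 i - \<phi> x i\<bar> \<le> e))"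

lemma approx_cong:
  assumes "approx N \<phi>" "\<And>x i. \<lbrakk>x \<in> K; i \<in> indices d\<rbrakk> \<Longrightarrow> \<phi> x i = \<psi> x i"
  shows "approx N \<psi>"
  using assms unfolding approx_def by simp

lemma approx_exact:
  assumes "is_cnn \<sigma> d k c N 1 f" "\<And>x i. \<lbrakk>x \<in> K; i \<in> indices d\<rbrakk> \<Longrightarrow> f x 1 i = \<phi> x i"
  shows "approx N \<phi>"
  unfolding approx_def using assms by (auto intro!: exI[of _ f])

lemma approx_closed:
  assumes "\<And>e. e > 0 \<Longrightarrow> \<exists>\<psi>. approx N \<psi> \<and> (\<forall>x\<in>K. \<forall>i\<in>indices d. \<bar>\<psi> x i - \<phi> x i\<bar> \<le> e)"
  shows "approx N \<phi>"
  unfolding approx_def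
proof (intro allI impI)
  fix e :: real assume "e > 0"
  then obtain \<psi> where \<psi>: "approx N \<psi>" "\<And>x i. \<lbrakk>x \<in> K; i \<in> indices d\<rbrakk> \<Longrightarrow> \<bar>\<psi> x i - \<phi> x i\<bar> \<le> e / 2"
    using assms[of "e / 2"] by auto
  obtain f where f: "is_cnn \<sigma> d k c N 1 f" "\<And>x i. \<lbrakk>x \<in> K; i \<in> indices d\<rbrakk> \<Longrightarrow> \<bar>f x 1 i - \<psi> x i\<bar> \<le> e / 2"
    using \<psi>(1) \<open>e > 0\<close> unfolding approx_def by (meson half_gt_zero)
  have "\<bar>f x 1 i - \<phi> x i\<bar> \<le> e" if "x \<in> K" "i \<in> indices d" for x i
    using f(2)[OF that] \<psi>(2)[OF that] by linarith
  then show "\<exists>f. is_cnn \<sigma> d k c N 1 f \<and> (\<forall>x\<in>K. \<forall>i\<in>indices d. \<bar>f x 1 i - \<phi> x i\<bar> \<le> e)"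
    using f(1) by blast
qed

lemma approx_linear:
  assumes "approx N \<phi>" "approx N \<psi>"
  shows "approx N (\<lambda>x i. a * \<phi> x i + b * \<psi> x i)"
  unfolding approx_def
proof (intro allI impI)
  fix e :: real assume e: "e > 0"
  \<comment> \<open>The summand 1 keeps the divisor positive when both coefficients vanish.\<close>
  define s where "s = \<bar>a\<bar> + \<bar>b\<bar> + 1"
  have s: "s > 0" by (simp add: s_def add_nonneg_pos)
  obtain f where f: "is_cnn \<sigma> d k c N 1 f" "\<And>x i. \<lbrakk>x \<in> K; i \<in> indices d\<rbrakk> \<Longrightarrow> \<bar>f x 1 i - \<phi> x i\<bar> \<le> e / s"
    using assms(1) e s unfolding approx_def by (meson divide_pos_pos)
  obtain g where g: "is_cnn \<sigma> d k c N 1 g" "\<And>x i. \<lbrakk>x \<in> K; i \<in> indices d\<rbrakk> \<Longrightarrow> \<bar>g x 1 i - \<psi> x i\<bar> \<le> e / s"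
    using assms(2) e s unfolding approx_def by (meson divide_pos_pos)
  obtain h where h: "is_cnn \<sigma> d k c N (1 + 1) h"
    "\<And>x. \<forall>j\<in>{1..1}. h x j = f x j" "\<And>x. \<forall>j\<in>{1..1}. h x (1 + j) = g x j"
    using is_cnn_pair[OF f(1) g(1)] by auto
  have h12: "h x 1 = f x 1" "h x 2 = g x 1" for x
    using h(2)[of x] h(3)[of x] by (auto simp: numeral_2_eq_2)
  define H where "H = (\<lambda>x i p. if i \<in> {1..1::nat} then
    (\<Sum>j = 1..1 + 1. (if j = 1 then a else b) * h x j p) + 0 * ones d p else 0)"
  have "is_cnn \<sigma> d k c N 1 H"
    unfolding H_def using is_cnn_post[OF h(1), of 1 "\<lambda>_ j. if j = 1 then a else b" "\<lambda>_. 0"] .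
  moreover have "\<bar>H x 1 i - (a * \<phi> x i + b * \<psi> x i)\<bar> \<le> e" if xi: "x \<in> K" "i \<in> indices d" for x i
  proof -
    have H: "H x 1 i = a * f x 1 i + b * g x 1 i"
      using h12[of x] by (simp add: H_def numeral_2_eq_2)
    have "\<bar>H x 1 i - (a * \<phi> x i + b * \<psi> x i)\<bar> = \<bar>a * (f x 1 i - \<phi> x i) + b * (g x 1 i - \<psi> x i)\<bar>"
      unfolding H by (simp add: algebra_simps)
    also have "\<dots> \<le> \<bar>a\<bar> * \<bar>f x 1 i - \<phi> x i\<bar> + \<bar>b\<bar> * \<bar>g x 1 i - \<psi> x i\<bar>"
      by (rule order_trans[OF abs_triangle_ineq]) (simp add: abs_mult)
    also have "\<dots> \<le> \<bar>a\<bar> * (e / s) + \<bar>b\<bar> * (e / s)"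
      using f(2)[OF xi] g(2)[OF xi] by (intro add_mono mult_left_mono) auto
    also have "\<dots> = (\<bar>a\<bar> + \<bar>b\<bar>) * (e / s)" by (rule distrib_right[symmetric])
    also have "\<dots> \<le> s * (e / s)" using e s by (intro mult_right_mono) (auto simp: s_def)
    finally show ?thesis using s by simp
  qed
  ultimately show "\<exists>f. is_cnn \<sigma> d k c N 1 f \<and>
      (\<forall>x\<in>K. \<forall>i\<in>indices d. \<bar>f x 1 i - (a * \<phi> x i + b * \<psi> x i)\<bar> \<le> e)" by blast
qed

lemma approx_add: "\<lbrakk>approx N \<phi>; approx N \<psi>\<rbrakk> \<Longrightarrow> approx N (\<lambda>x i. \<phi> x i + \<psi> x i)"
  using approx_linear[of N \<phi> \<psi> 1 1] by simp

lemma approx_scale: "approx N \<phi> \<Longrightarrow> approx N (\<lambda>x i. a * \<phi> x i)"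
  using approx_linear[of N \<phi> \<phi> a 0] by simp

lemma approx_const:
  assumes "N \<ge> 1"
  shows "approx N (\<lambda>_ _. a)"
proof -
  obtain f where f: "is_cnn \<sigma> d k c N 1 f" using is_cnn_exists[OF assms] by blast
  show ?thesis
    by (rule approx_exact[OF is_cnn_post[OF f, of 1 "\<lambda>_ _. 0" "\<lambda>_. a"]]) (simp add: ones_def)
qed

lemma approx_sum:
  assumes "N \<ge> 1" "finite S" "\<And>s. s \<in> S \<Longrightarrow> approx N (\<phi> s)"
  shows "approx N (\<lambda>x i. \<Sum>s\<in>S. \<phi> s x i)"
  using assms(2,3)
  by (induction S rule: finite_induct) (auto simp: approx_const[OF assms(1)] approx_add)

lemma approx_bounded:
  assumes "approx N \<phi>"
  shows "\<exists>B. \<forall>x\<in>K. \<forall>i\<in>indices d. \<bar>\<phi> x i\<bar> \<le> B"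
proof -
  obtain f where f: "is_cnn \<sigma> d k c N 1 f" "\<And>x i. \<lbrakk>x \<in> K; i \<in> indices d\<rbrakk> \<Longrightarrow> \<bar>f x 1 i - \<phi> x i\<bar> \<le> 1"
    using assms unfolding approx_def by (meson zero_less_one)
  have "\<exists>B. \<forall>x\<in>K. \<bar>f x 1 i\<bar> \<le> B" for i
  proof -
    have "continuous_on K (\<lambda>x. f x 1 i)"
      using continuous_on_compose2[OF continuous_on_coordinate[of UNIV] continuous_on_cnn[OF f(1) cont]]
      by simp
    then have "compact ((\<lambda>x. f x 1 i) ` K)" using compact by (rule compact_continuous_image)
    then show ?thesis by (auto dest!: compact_imp_bounded simp: bounded_iff)
  qed
  then obtain B where B: "\<And>x i. x \<in> K \<Longrightarrow> \<bar>f x 1 i\<bar> \<le> B i" by metis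
  have "\<bar>\<phi> x i\<bar> \<le> Max (B ` indices d) + 1" if "x \<in> K" "i \<in> indices d" for x i
  proof -
    have "B i \<le> Max (B ` indices d)" using that by (intro Max_ge) auto
    then show ?thesis using B[OF that(1), of i] f(2)[OF that] by linarith
  qed
  then show ?thesis by blast
qed

text \<open>\<phi> is bounded on K and \<sigma> is uniformly continuous on a slightly larger
  interval, so a network close to \<phi> stays close after the activation. The convolution
  multiplies the error at most by the sum of the absolute values of w.\<close>

lemma approx_activation:
  assumes \<phi>: "approx N \<phi>"
  shows "approx (Suc N) (\<lambda>x. conv d k w (mask d (\<lambda>i. \<sigma> (\<phi> x i))))"
  unfolding approx_def
proof (intro allI impI)
  fix e :: real assume e: "e > 0"
  define s where "s = (\<Sum>j\<in>kernel_range k. \<bar>w j\<bar>) + 1"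
  have s: "s > 0" by (simp add: s_def add_nonneg_pos sum_nonneg)
  obtain B where B: "\<And>x i. \<lbrakk>x \<in> K; i \<in> indices d\<rbrakk> \<Longrightarrow> \<bar>\<phi> x i\<bar> \<le> B"
    using approx_bounded[OF \<phi>] by blast
  obtain \<delta> where \<delta>: "\<delta> > 0"
    "\<And>x y. \<lbrakk>\<bar>x\<bar> \<le> B + 1; \<bar>y\<bar> \<le> B + 1; \<bar>x - y\<bar> < \<delta>\<rbrakk> \<Longrightarrow> \<bar>\<sigma> x - \<sigma> y\<bar> < e / s"
    using modulus_on_interval[OF cont, of "e / s" "B + 1"] e s by (metis divide_pos_pos)
  \<comment> \<open>The bound 1 keeps the values of the network in [-B-1, B+1]; \<delta>/2 is
    strictly below the modulus.\<close>
  have "min 1 (\<delta> / 2) > 0" using \<delta> by simp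
  then obtain f where f: "is_cnn \<sigma> d k c N 1 f"
    "\<And>x i. \<lbrakk>x \<in> K; i \<in> indices d\<rbrakk> \<Longrightarrow> \<bar>f x 1 i - \<phi> x i\<bar> \<le> min 1 (\<delta> / 2)"
    using \<phi> unfolding approx_def by meson
  let ?C = "conv_layer d k 1 1 (\<lambda>_ _. w) (\<lambda>_. 0)"
  have "is_cnn \<sigma> d k c (Suc N) 1 (?C \<circ> activate \<sigma> 1 d \<circ> f)"
    using f(1) by (intro is_cnn.layer) (auto simp: conv_layers_def)
  moreover have "\<bar>(?C \<circ> activate \<sigma> 1 d \<circ> f) x 1 p - conv d k w (mask d (\<lambda>i. \<sigma> (\<phi> x i))) p\<bar> \<le> e"
    if x: "x \<in> K" for x p
  proof -
    have "activate \<sigma> 1 d (f x) 1 = mask d (\<lambda>i. \<sigma> (f x 1 i))"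
      by (simp add: activate_def mask_def)
    then have "(?C \<circ> activate \<sigma> 1 d \<circ> f) x 1 p = conv d k w (mask d (\<lambda>i. \<sigma> (f x 1 i))) p"
      by (simp add: conv_layer_def)
    moreover have "\<bar>\<sigma> (f x 1 i) - \<sigma> (\<phi> x i)\<bar> \<le> e / s" if "i \<in> indices d" for i
      using B[OF x that] f(2)[OF x that] \<delta>(1) by (intro less_imp_le[OF \<delta>(2)]) linarith+
    ultimately have "\<bar>(?C \<circ> activate \<sigma> 1 d \<circ> f) x 1 p - conv d k w (mask d (\<lambda>i. \<sigma> (\<phi> x i))) p\<bar>
        \<le> (\<Sum>j\<in>kernel_range k. \<bar>w j\<bar>) * (e / s)"
      using conv_mask_diff_le[of d "\<lambda>i. \<sigma> (f x 1 i)" "\<lambda>i. \<sigma> (\<phi> x i)" "e / s"] e s by simp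
    also have "\<dots> \<le> s * (e / s)" using e s by (intro mult_right_mono) (auto simp: s_def)
    finally show ?thesis using s by simp
  qed
  ultimately show "\<exists>f. is_cnn \<sigma> d k c (Suc N) 1 f \<and>
      (\<forall>x\<in>K. \<forall>i\<in>indices d. \<bar>f x 1 i - conv d k w (mask d (\<lambda>i. \<sigma> (\<phi> x i))) i\<bar> \<le> e)" by blast
qed

lemma approx_conv_product:
  assumes nonpoly: "\<not> (\<exists>p. \<forall>x. \<sigma> x = poly p x)" and N: "N \<ge> 1"
    and \<phi>s: "\<And>\<phi>. \<phi> \<in> set \<phi>s \<Longrightarrow> approx N \<phi>"
  shows "approx (Suc N) (\<lambda>x. conv d k w (mask d (\<lambda>i. \<Prod>\<phi>\<leftarrow>\<phi>s. \<phi> x i)))"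
proof -
  define W where "W = {\<phi>. approx N (\<lambda>x i. \<phi> (x, i))}"
  \<comment> \<open>Quantifying over all kernels makes \<open>V\<close> a condition on the hidden
    layer alone. Convolution is linear and bounded, so \<open>V\<close> is a linear space closed
    under uniform limits.\<close>
  define V where "V = {u. \<forall>w. approx (Suc N) (\<lambda>x. conv d k w (mask d (\<lambda>i. u (x, i))))}"
  interpret activation_span "K \<times> indices d" W V \<sigma>
  proof
    show "continuous_on UNIV \<sigma>" by (rule cont)
    show "(\<lambda>z. \<sigma> (\<psi> z)) \<in> V" if "\<psi> \<in> W" for \<psi>
      using that unfolding W_def V_def by (auto intro!: approx_activation)
    have mask: "mask d (\<lambda>i. u (x, i) + v (x, i)) = (\<lambda>i. 1 * mask d (\<lambda>i. u (x, i)) i + 1 * mask d (\<lambda>i. v (x, i)) i)"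
      "mask d (\<lambda>i. a * u (x, i)) = (\<lambda>i. a * mask d (\<lambda>i. u (x, i)) i + 0 * mask d (\<lambda>i. u (x, i)) i)"
      for u v :: "'n ctensor \<times> (int ^ 'n) \<Rightarrow> real" and x a
      by (auto simp: mask_def)
    show "(\<lambda>z. u z + v z) \<in> V" if "u \<in> V" "v \<in> V" for u v
      using that unfolding V_def mask conv_linear mem_Collect_eq
      by (intro allI approx_linear) auto
    show "(\<lambda>z. a * u z) \<in> V" if "u \<in> V" for u a
      using that unfolding V_def mask conv_linear mem_Collect_eq
      by (intro allI approx_linear) auto
    show "u \<in> V" if close: "\<And>e. e > 0 \<Longrightarrow> \<exists>v\<in>V. \<forall>z\<in>K \<times> indices d. \<bar>v z - u z\<bar> \<le> e" for u
      unfolding V_def mem_Collect_eq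
    proof (intro allI approx_closed)
      fix w :: "'n tensor" and e :: real assume e: "e > 0"
      define s where "s = (\<Sum>j\<in>kernel_range k. \<bar>w j\<bar>) + 1"
      have s: "s > 0" by (simp add: s_def add_nonneg_pos sum_nonneg)
      then obtain v where v: "v \<in> V" "\<And>x i. \<lbrakk>x \<in> K; i \<in> indices d\<rbrakk> \<Longrightarrow> \<bar>v (x, i) - u (x, i)\<bar> \<le> e / s"
        using close[of "e / s"] e by auto
      have "\<bar>conv d k w (mask d (\<lambda>i. v (x, i))) p - conv d k w (mask d (\<lambda>i. u (x, i))) p\<bar> \<le> e"
        if "x \<in> K" for x p
      proof -
        have "\<bar>conv d k w (mask d (\<lambda>i. v (x, i))) p - conv d k w (mask d (\<lambda>i. u (x, i))) p\<bar>
            \<le> (\<Sum>j\<in>kernel_range k. \<bar>w j\<bar>) * (e / s)"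
          using v(2)[OF that] e s by (intro conv_mask_diff_le) auto
        also have "\<dots> \<le> s * (e / s)" using e s by (intro mult_right_mono) (auto simp: s_def)
        finally show ?thesis using s by simp
      qed
      then show "\<exists>\<psi>. approx (Suc N) \<psi> \<and>
          (\<forall>x\<in>K. \<forall>i\<in>indices d. \<bar>\<psi> x i - conv d k w (mask d (\<lambda>i. u (x, i))) i\<bar> \<le> e)"
        using v(1) by (intro exI[of _ "\<lambda>x. conv d k w (mask d (\<lambda>i. v (x, i)))"]) (auto simp: V_def)
    qed
  qed (use N in \<open>auto simp: W_def approx_add approx_scale approx_const dest: approx_bounded\<close>)
  have "(\<lambda>z. \<Prod>\<phi>\<leftarrow>map (\<lambda>\<phi> (x, i). \<phi> x i) \<phi>s. \<phi> z) \<in> V"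
    using \<phi>s by (intro product_in_V nonpoly) (auto simp: W_def)
  then show ?thesis
    by (simp add: V_def comp_def)
qed

end

section \<open>Monomials at the minimal depth\<close>

lemma conv_delta:
  assumes "r \<in> kernel_range k"
  shows "conv d k (\<lambda>j. if j = r then 1 else 0) u p = (if p \<in> indices d then u (p - r) else 0)"
proof -
  have "(\<Sum>j\<in>kernel_range k. (if j = r then 1 else 0) * u (p - j)) = (\<Sum>j\<in>kernel_range k. if j = r then u (p - j) else 0)"
    by (intro sum.cong) auto
  then show ?thesis using assms by (simp add: conv_def)
qed

lemma ctensors_eq_0: "\<lbrakk>x \<in> ctensors c d; \<not> (j \<in> {1..c} \<and> i \<in> indices d)\<rbrakk> \<Longrightarrow> x j i = 0"
  by (auto simp: ctensors_def)

locale cnn3_approximation = cnn_approximation \<sigma> d "\<chi> t. 1" c K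
  for \<sigma> :: "real \<Rightarrow> real" and d :: "nat ^ 'n" and c :: nat and K :: "'n ctensor set" +
  assumes K_subset: "K \<subseteq> ctensors c d" and nonpoly: "\<not> (\<exists>p. \<forall>x. \<sigma> x = poly p x)"
begin

section \<open>Shifts of the input and boundary indicators\<close>

lemma approx_shift_product:
  assumes "N \<ge> 1" "\<And>\<phi>. \<phi> \<in> set \<phi>s \<Longrightarrow> approx N \<phi>" "\<And>t. \<bar>r $ t\<bar> \<le> 1"
  shows "approx (Suc N) (\<lambda>x i. mask d (\<lambda>i. \<Prod>\<phi>\<leftarrow>\<phi>s. \<phi> x i) (i - r))"
proof -
  have r: "r \<in> kernel_range (\<chi> t. 1)" using assms(3) by (simp add: kernel_range_def)
  have "approx (Suc N) (\<lambda>x. conv d (\<chi> t. 1) (\<lambda>j. if j = r then 1 else 0) (mask d (\<lambda>i. \<Prod>\<phi>\<leftarrow>\<phi>s. \<phi> x i)))"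
    using assms(1,2) by (intro approx_conv_product nonpoly)
  then show ?thesis
    by (rule approx_cong) (simp add: conv_delta[OF r] del: One_nat_def)
qed

text \<open>A product with a single factor passes the hidden layer through unchanged, so one more
  layer adds one unit step to the available shifts.\<close>

lemma approx_shift_Suc:
  assumes z: "\<And>x i. \<lbrakk>x \<in> K; i \<notin> indices d\<rbrakk> \<Longrightarrow> z x i = 0" and N: "N \<ge> 1"
    and approx: "\<And>r. (\<And>t. \<bar>r $ t\<bar> \<le> int n) \<Longrightarrow> approx N (\<lambda>x i. z x (i + r))"
    and r: "\<And>t. \<bar>r $ t\<bar> \<le> int (Suc n)"
  shows "approx (Suc N) (\<lambda>x i. z x (i + r))"
proof -
  \<comment> \<open>A step in the direction of \<open>r\<close>: once it leaves the index range, so does the whole shift.\<close>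
  define s :: "int ^ 'n" where "s = (\<chi> t. sgn (r $ t))"
  have s: "\<bar>s $ t\<bar> \<le> 1" "\<bar>(r - s) $ t\<bar> \<le> int n" for t
    using r[of t] by (auto simp: s_def sgn_if)
  have "approx (Suc N) (\<lambda>x i. mask d (\<lambda>i. \<Prod>\<phi>\<leftarrow>[\<lambda>x i. z x (i + (r - s))]. \<phi> x i) (i - - s))"
    using approx[of "r - s"] s N by (intro approx_shift_product) auto
  moreover have "mask d (\<lambda>i. \<Prod>\<phi>\<leftarrow>[\<lambda>x i. z x (i + (r - s))]. \<phi> x i) (i - - s) = z x (i + r)"
    if xi: "x \<in> K" "i \<in> indices d" for x i
  proof (cases "i + s \<in> indices d")
    case True
    then show ?thesis by (simp add: mask_def algebra_simps)
  next
    case False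
    then obtain t where t: "\<not> (1 \<le> i $ t + s $ t \<and> i $ t + s $ t \<le> int (d $ t))"
      by (auto simp: indices_def)
    have "1 \<le> i $ t \<and> i $ t \<le> int (d $ t)" using xi by (auto simp: indices_def)
    then have "\<not> (1 \<le> i $ t + r $ t \<and> i $ t + r $ t \<le> int (d $ t))"
      using t by (auto simp: s_def sgn_if split: if_splits)
    then have "i + r \<notin> indices d"
      unfolding indices_def by (auto intro!: exI[of _ t])
    then show ?thesis using False z[OF xi(1)] by (simp add: mask_def)
  qed
  ultimately show ?thesis
    by (rule approx_cong)
qed

lemma approx_coordinate_shift:
  assumes j: "j \<in> {1..c}" and N: "N \<ge> 1" and r: "\<And>t. \<bar>r $ t\<bar> \<le> int N"
  shows "approx N (\<lambda>x i. x j (i + r))"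
  using N r
proof (induction N arbitrary: r rule: nat_induct_at_least)
  case base
  let ?w = "\<lambda>(_ :: nat) l q. if l = j then if q = - r then 1 else 0 else 0 :: real"
  have r: "- r \<in> kernel_range (\<chi> t. 1)" using base by (simp add: kernel_range_def)
  show ?case
  proof (rule approx_exact)
    show "is_cnn \<sigma> d (\<chi> t. 1) c 1 1 (conv_layer d (\<chi> t. 1) c 1 ?w (\<lambda>_. 0))"
      by (intro is_cnn.single) (auto simp: conv_layers_def)
    fix x i assume i: "i \<in> indices d"
    have "(\<Sum>l = 1..c. conv d (\<chi> t. 1) (?w 1 l) (x l) i)
        = (\<Sum>l = 1..c. if l = j then conv d (\<chi> t. 1) (\<lambda>q. if q = - r then 1 else 0) (x l) i else 0)"
      by (intro sum.cong) auto
    also have "\<dots> = x j (i + r)" using j i by (simp add: conv_delta[OF r] del: One_nat_def)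
    finally show "conv_layer d (\<chi> t. 1) c 1 ?w (\<lambda>_. 0) x 1 i = x j (i + r)"
      by (simp add: conv_layer_def)
  qed
next
  case (Suc N)
  show ?case
    by (rule approx_shift_Suc[OF _ Suc.hyps Suc.IH Suc.prems]) (use K_subset in \<open>auto intro: ctensors_eq_0\<close>)
qed

text \<open>The reach is N - 1 rather than N: the bias of a first layer is the same at all
  positions, and the padding makes the boundary of a constant visible only from the second layer on,
  one further position per layer.\<close>

lemma approx_ones_shift:
  assumes N: "N \<ge> 1" and r: "\<And>t. \<bar>r $ t\<bar> \<le> int N - 1"
  shows "approx N (\<lambda>_ i. ones d (i + r))"
  using N r
proof (induction N arbitrary: r rule: nat_induct_at_least)
  case base
  then have "r = 0" by (simp add: vec_eq_iff)
  then show ?case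
    by (intro approx_cong[OF approx_const[of 1 1]]) (auto simp: ones_def)
next
  case (Suc N)
  show ?case
  proof (rule approx_shift_Suc[where z = "\<lambda>_. ones d" and n = "N - 1"])
    show "approx N (\<lambda>_ i. ones d (i + r))" if "\<And>t. \<bar>r $ t\<bar> \<le> int (N - 1)" for r
      using that Suc.hyps by (intro Suc.IH) (simp add: of_nat_diff)
    show "\<bar>r $ t\<bar> \<le> int (Suc (N - 1))" for t
      using Suc.prems[of t] Suc.hyps by simp
  qed (use Suc.hyps in \<open>auto simp: ones_def\<close>)
qed

lemma ones_axis:
  "q \<in> indices d \<Longrightarrow> ones d (q + axis t a) = (if 1 \<le> q $ t + a \<and> q $ t + a \<le> int (d $ t) then 1 else 0)"
  by (auto simp: ones_def indices_def axis_def)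

text \<open>U is the indicator of the positions whose coordinate t is at most \<open>q $ t\<close>.
  Shifting \<open>ones d\<close> by \<open>d $ t - q $ t\<close> pushes the larger ones out at the
  top. Alternatively, shifting by \<open>- q $ t\<close> pushes exactly the others out at the
  bottom, and the complement is taken. The hypothesis says that one of the two shifts is short
  enough for depth n.\<close>

lemma upper_label:
  assumes n: "n \<ge> 1" and q: "q \<in> indices d"
    and "int (d $ t) - q $ t \<le> int n - 1 \<or> q $ t \<le> int n - 1"
  obtains U where "approx n (\<lambda>_. U)" "U q = 1" "\<And>i. \<lbrakk>i \<in> indices d; i $ t > q $ t\<rbrakk> \<Longrightarrow> U i = 0"
proof -
  have qt: "1 \<le> q $ t" "q $ t \<le> int (d $ t)" using q by (auto simp: indices_def)
  have it: "1 \<le> i $ t \<and> i $ t \<le> int (d $ t)" if "i \<in> indices d" for i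
    using that by (auto simp: indices_def)
  from assms(3) show ?thesis
  proof
    assume "int (d $ t) - q $ t \<le> int n - 1"
    then have "approx n (\<lambda>_ i. ones d (i + axis t (int (d $ t) - q $ t)))"
      using n qt by (intro approx_ones_shift) (auto simp: axis_def)
    then show ?thesis
      by (rule that) (use q qt in \<open>auto simp: ones_axis\<close>)
  next
    assume "q $ t \<le> int n - 1"
    then have "approx n (\<lambda>_ i. ones d (i + axis t (- q $ t)))"
      using n qt by (intro approx_ones_shift) (auto simp: axis_def)
    then have "approx n (\<lambda>_ i. 1 * 1 + (- 1) * ones d (i + axis t (- q $ t)))"
      using n by (intro approx_linear approx_const)
    then show ?thesis
      by (rule that) (use q qt in \<open>auto simp: ones_axis dest: it\<close>)
  qed
qed

text \<open>The mirror image; the shifts are \<open>1 - q $ t\<close> and, for the complement,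
  \<open>d $ t + 1 - q $ t\<close>.\<close>

lemma lower_label:
  assumes n: "n \<ge> 1" and q: "q \<in> indices d"
    and "q $ t - 1 \<le> int n - 1 \<or> int (d $ t) + 1 - q $ t \<le> int n - 1"
  obtains U where "approx n (\<lambda>_. U)" "U q = 1" "\<And>i. \<lbrakk>i \<in> indices d; i $ t < q $ t\<rbrakk> \<Longrightarrow> U i = 0"
proof -
  have qt: "1 \<le> q $ t" "q $ t \<le> int (d $ t)" using q by (auto simp: indices_def)
  have it: "1 \<le> i $ t \<and> i $ t \<le> int (d $ t)" if "i \<in> indices d" for i
    using that by (auto simp: indices_def)
  from assms(3) show ?thesis
  proof
    assume "q $ t - 1 \<le> int n - 1"
    then have "approx n (\<lambda>_ i. ones d (i + axis t (1 - q $ t)))"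
      using n qt by (intro approx_ones_shift) (auto simp: axis_def)
    then show ?thesis
      by (rule that) (use q qt in \<open>auto simp: ones_axis\<close>)
  next
    assume "int (d $ t) + 1 - q $ t \<le> int n - 1"
    then have "approx n (\<lambda>_ i. ones d (i + axis t (int (d $ t) + 1 - q $ t)))"
      using n qt by (intro approx_ones_shift) (auto simp: axis_def)
    then have "approx n (\<lambda>_ i. 1 * 1 + (- 1) * ones d (i + axis t (int (d $ t) + 1 - q $ t)))"
      using n by (intro approx_linear approx_const)
    then show ?thesis
      by (rule that) (use q qt in \<open>auto simp: ones_axis dest: it\<close>)
  qed
qed

text \<open>The product is formed at the hidden position q, from where \<open>field\<close> keeps
  all factors within reach, and the last kernel moves it to p. All other hidden positions must be
  silenced: \<open>upper\<close> and \<open>lower\<close> list, per direction, what excludes those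
  above and below q. This is a factor at the border that slides into the padding, a label in one of
  its two forms, or p at the border, in which case the moved position falls outside the
  range.\<close>

lemma approx_monomial:
  assumes n: "n \<ge> 1" and p: "p \<in> indices d" and q: "q \<in> indices d"
    and ms: "\<And>j m. (j, m) \<in> set ms \<Longrightarrow> j \<in> {1..c} \<and> m \<in> indices d"
    and pq: "\<And>t. \<bar>p $ t - q $ t\<bar> \<le> 1"
    and field: "\<And>j m t. (j, m) \<in> set ms \<Longrightarrow> \<bar>m $ t - q $ t\<bar> \<le> int n"
    and upper: "\<And>t. (\<exists>(j, m)\<in>set ms. m $ t = int (d $ t)) \<or>
      int (d $ t) - q $ t \<le> int n - 1 \<or> q $ t \<le> int n - 1 \<or> p $ t = int (d $ t)"
    and lower: "\<And>t. (\<exists>(j, m)\<in>set ms. m $ t = 1) \<or>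
      q $ t - 1 \<le> int n - 1 \<or> int (d $ t) + 1 - q $ t \<le> int n - 1 \<or> p $ t = 1"
  shows "approx (Suc n) (\<lambda>x i. if i = p then \<Prod>(j, m)\<leftarrow>ms. x j m else 0)"
proof -
  have "\<exists>U. approx n (\<lambda>_. U) \<and> U q = 1 \<and>
      ((\<exists>(j, m)\<in>set ms. m $ t = int (d $ t)) \<or> p $ t = int (d $ t) \<or> (\<forall>i\<in>indices d. i $ t > q $ t \<longrightarrow> U i = 0))" for t
  proof (cases "int (d $ t) - q $ t \<le> int n - 1 \<or> q $ t \<le> int n - 1")
    case True
    show ?thesis by (rule upper_label[OF n q True]) blast
  next
    case False
    \<comment> \<open>The constant 1 is a neutral factor; exclusion upwards then rests on a factor
      of the monomial or on p.\<close>
    then show ?thesis using upper[of t] n by (intro exI[of _ "\<lambda>_. 1"]) (auto intro: approx_const simp del: One_nat_def)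
  qed
  then obtain U where U: "\<And>t. approx n (\<lambda>_. U t)" "\<And>t. U t q = 1"
    "\<And>t. (\<exists>(j, m)\<in>set ms. m $ t = int (d $ t)) \<or> p $ t = int (d $ t) \<or> (\<forall>i\<in>indices d. i $ t > q $ t \<longrightarrow> U t i = 0)"
    by metis
  have "\<exists>L. approx n (\<lambda>_. L) \<and> L q = 1 \<and>
      ((\<exists>(j, m)\<in>set ms. m $ t = 1) \<or> p $ t = 1 \<or> (\<forall>i\<in>indices d. i $ t < q $ t \<longrightarrow> L i = 0))" for t
  proof (cases "q $ t - 1 \<le> int n - 1 \<or> int (d $ t) + 1 - q $ t \<le> int n - 1")
    case True
    show ?thesis by (rule lower_label[OF n q True]) blast
  next
    case False
    then show ?thesis using lower[of t] n by (intro exI[of _ "\<lambda>_. 1"]) (auto intro: approx_const simp del: One_nat_def)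
  qed
  then obtain L where L: "\<And>t. approx n (\<lambda>_. L t)" "\<And>t. L t q = 1"
    "\<And>t. (\<exists>(j, m)\<in>set ms. m $ t = 1) \<or> p $ t = 1 \<or> (\<forall>i\<in>indices d. i $ t < q $ t \<longrightarrow> L t i = 0)"
    by metis
  obtain ts :: "'n list" where ts: "set ts = UNIV" using finite_list[OF finite] by blast
  \<comment> \<open>At position q the shift by m - q reads the entry m, and all labels equal
    1.\<close>
  define \<phi>s where "\<phi>s = map (\<lambda>(j, m) x i. x j (i + (m - q))) ms @
    map (\<lambda>t (_ :: 'n ctensor). U t) ts @ map (\<lambda>t _. L t) ts"
  have "approx (Suc n) (\<lambda>x i. mask d (\<lambda>i. \<Prod>\<phi>\<leftarrow>\<phi>s. \<phi> x i) (i - (p - q)))"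
  proof (rule approx_shift_product[OF n])
    fix \<phi> assume "\<phi> \<in> set \<phi>s"
    then show "approx n \<phi>"
      using U(1) L(1) ms field by (auto simp: \<phi>s_def simp del: One_nat_def intro!: approx_coordinate_shift[OF _ n])
  qed (use pq in simp)
  moreover have "mask d (\<lambda>i. \<Prod>\<phi>\<leftarrow>\<phi>s. \<phi> x i) (i - (p - q)) = (if i = p then \<Prod>(j, m)\<leftarrow>ms. x j m else 0)"
    if x: "x \<in> K" and i: "i \<in> indices d" for x i
  proof (cases "i = p")
    case True
    have one: "(\<Prod>t\<leftarrow>ts. U t q) = 1" "(\<Prod>t\<leftarrow>ts. L t q) = 1"
      by (simp_all add: U(2) L(2) map_replicate_const)
    show ?thesis
      using True q one by (simp add: mask_def \<phi>s_def comp_def case_prod_unfold)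
  next
    case False
    define i' where "i' = i - (p - q)"
    have "(\<Prod>\<phi>\<leftarrow>\<phi>s. \<phi> x i') = 0" if i': "i' \<in> indices d"
    proof -
      have "i' \<noteq> q" using False by (auto simp: i'_def)
      then obtain t where t: "i' $ t \<noteq> q $ t" by (auto simp: vec_eq_iff)
      have it: "i $ t = i' $ t - q $ t + p $ t" by (simp add: i'_def)
      have it': "1 \<le> i $ t" "i $ t \<le> int (d $ t)" using i by (auto simp: indices_def)
      have factor_eq_0: "x j (i' + (m - q)) = 0"
        if "\<not> (1 \<le> i' $ t + (m $ t - q $ t) \<and> i' $ t + (m $ t - q $ t) \<le> int (d $ t))" for j m
        using that x K_subset by (intro ctensors_eq_0) (auto simp: indices_def intro!: exI[of _ t])
      have in_\<phi>s: "(\<lambda>x i. x j (i + (m - q))) \<in> set \<phi>s" if "(j, m) \<in> set ms" for j m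
        using that by (force simp: \<phi>s_def)
      have "\<exists>\<phi>\<in>set \<phi>s. \<phi> x i' = 0"
      proof (cases "i' $ t > q $ t")
        case True
        \<comment> \<open>The alternative \<open>p $ t = int (d $ t)\<close> is ruled out, since i
          would lie beyond the range.\<close>
        consider (factor) j m where "(j, m) \<in> set ms" "m $ t = int (d $ t)" | (label) "U t i' = 0"
          using U(3)[of t] True it it' i' by fastforce
        then show ?thesis
        proof cases
          case factor
          with True show ?thesis by (intro bexI[OF _ in_\<phi>s[of j m]] factor_eq_0) auto
        next
          case label
          have "(\<lambda>_. U t) \<in> set \<phi>s" by (simp add: \<phi>s_def ts)
          with label show ?thesis by (intro bexI[of _ "\<lambda>_. U t"])
        qed
      next
        case False
        then have less: "i' $ t < q $ t" using t by simp
        consider (factor) j m where "(j, m) \<in> set ms" "m $ t = 1" | (label) "L t i' = 0"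
          using L(3)[of t] less it it' i' by fastforce
        then show ?thesis
        proof cases
          case factor
          with less show ?thesis by (intro bexI[OF _ in_\<phi>s[of j m]] factor_eq_0) auto
        next
          case label
          have "(\<lambda>_. L t) \<in> set \<phi>s" by (simp add: \<phi>s_def ts)
          with label show ?thesis by (intro bexI[of _ "\<lambda>_. L t"])
        qed
      qed
      then show ?thesis by (auto simp: prod_list_zero_iff)
    qed
    then show ?thesis using False by (simp add: mask_def flip: i'_def)
  qed
  ultimately show ?thesis
    by (rule approx_cong)
qed

end

text \<open>The intermediate position in the last hidden layer must see all factors of the monomial,
  and must be separable from all other positions that contribute to output entries.\<close>

lemma intermediate_position:
  fixes d M N p :: int
  assumes A: "\<And>m. m \<in> A \<Longrightarrow> 1 \<le> m \<and> m \<le> d" and "1 \<le> d" "d \<le> M" "1 \<le> p" "p \<le> d"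
    and N: "N = (if M \<le> 2 then 2 else if M = 3 then 3 else M - 1)"
  shows "\<exists>q. 1 \<le> q \<and> q \<le> d \<and> \<bar>p - q\<bar> \<le> 1 \<and> (\<forall>m\<in>A. \<bar>m - q\<bar> \<le> N - 1) \<and>
    (d \<in> A \<or> d - q \<le> N - 2 \<or> q \<le> N - 2 \<or> p = d) \<and>
    (1 \<in> A \<or> q - 1 \<le> N - 2 \<or> d + 1 - q \<le> N - 2 \<or> p = 1)"
proof -
  consider "M \<le> 2" | "M = 3" | "M \<ge> 4" "d < M" | "M \<ge> 5" "d = M" | "M = 4" "d = 4" "p \<le> 2"
    | "M = 4" "d = 4" "p \<ge> 3"
    using assms by linarith
  then show ?thesis
  proof cases
    case 1
    \<comment> \<open>At depth 2 the indicators cannot be shifted. With d = 2, one side is settled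
      because q lies at that border, the other because p lies at the opposite one.\<close>
    then show ?thesis using assms by (intro exI[of _ "d + 1 - p"]) fastforce
  next
    case 2
    then show ?thesis using assms by (intro exI[of _ p]) fastforce
  next
    case 3
    then show ?thesis using assms by (intro exI[of _ p]) fastforce
  next
    case 4
    \<comment> \<open>Reach d - 2 covers all entries only from positions off both borders, so p is
      clamped into [2, d - 1]. At q = 2 and at q = d - 1 one side needs the complement label, which
      is where M \<ge> 5 enters.\<close>
    then show ?thesis using assms by (intro exI[of _ "max 2 (min p (d - 1))"]) fastforce
  next
    case 5
    \<comment> \<open>With M = 4 no label excludes the positions above q = 2. If 4 occurs in the
      monomial, that factor does so; otherwise q = 1 sees every factor and has a label.\<close>
    show ?thesis
    proof (cases "4 \<in> A")
      case True
      then show ?thesis using 5 assms by (intro exI[of _ 2]) fastforce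
    next
      case False
      then have "m \<le> 3" if "m \<in> A" for m using A[OF that] that 5 by (cases "m = 4") auto
      then show ?thesis using 5 assms by (intro exI[of _ 1]) fastforce
    qed
  next
    case 6
    show ?thesis
    proof (cases "1 \<in> A")
      case True
      then show ?thesis using 6 assms by (intro exI[of _ 3]) fastforce
    next
      case False
      then have "m \<ge> 2" if "m \<in> A" for m using A[OF that] that 6 by (cases "m = 1") auto
      then show ?thesis using 6 assms by (intro exI[of _ 4]) fastforce
    qed
  qed
qed

lemma min_depth_eq:
  fixes d :: "nat ^ 'n"
  assumes "\<And>t. d $ t \<ge> 1"
  obtains s where "\<And>t. d $ t \<le> d $ s"
    "int (min_depth d) = (if int (d $ s) \<le> 2 then 2 else if int (d $ s) = 3 then 3 else int (d $ s) - 1)"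
proof -
  have "Max (range (\<lambda>t. d $ t)) \<in> range (\<lambda>t. d $ t)" by (intro Max_in) auto
  then obtain s where s: "Max (range (\<lambda>t. d $ t)) = d $ s" by blast
  have "d $ t \<le> d $ s" for t unfolding s[symmetric] by (intro Max_ge) auto
  moreover have "int (min_depth d) = (if int (d $ s) \<le> 2 then 2 else if int (d $ s) = 3 then 3 else int (d $ s) - 1)"
    using assms[of s] by (auto simp: min_depth_def Let_def s)
  ultimately show ?thesis by (rule that)
qed

section \<open>Universality at the minimal depth\<close>

text \<open>Built from monomials by sums only, so that approximability follows from that of
  monomials by linearity; closure under products is derived afterwards.\<close>

inductive_set coordinate_polynomials :: "nat \<Rightarrow> nat ^ 'n \<Rightarrow> ('n ctensor \<Rightarrow> real) set" for c d where
  monomial: "(\<And>j m. (j, m) \<in> set ms \<Longrightarrow> j \<in> {1..c} \<and> m \<in> indices d) \<Longrightarrow>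
    (\<lambda>x. a * (\<Prod>(j, m)\<leftarrow>ms. x j m)) \<in> coordinate_polynomials c d"
| add: "\<lbrakk>u \<in> coordinate_polynomials c d; v \<in> coordinate_polynomials c d\<rbrakk> \<Longrightarrow>
    (\<lambda>x. u x + v x) \<in> coordinate_polynomials c d"

lemma coordinate_polynomials_mult:
  assumes "u \<in> coordinate_polynomials c d" "v \<in> coordinate_polynomials c d"
  shows "(\<lambda>x. u x * v x) \<in> coordinate_polynomials c d"
  using assms
proof (induction arbitrary: v rule: coordinate_polynomials.induct)
  case (monomial ms a)
  from monomial.prems show ?case
  proof (induction rule: coordinate_polynomials.induct)
    case (monomial ms' a')
    have "(\<lambda>x. (a * a') * (\<Prod>(j, m)\<leftarrow>ms @ ms'. x j m)) \<in> coordinate_polynomials c d"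
      using monomial.hyps \<open>\<And>j m. (j, m) \<in> set ms \<Longrightarrow> _\<close> by (intro coordinate_polynomials.monomial) auto
    then show ?case by (simp add: mult_ac)
  next
    case (add u v)
    from coordinate_polynomials.add[OF add.IH] show ?case by (simp add: distrib_left)
  qed
next
  case (add u u')
  from coordinate_polynomials.add[OF add.IH[OF add.prems]] show ?case by (simp add: distrib_right)
qed

lemma continuous_on_coordinate_polynomials:
  fixes d :: "nat ^ 'n"
  assumes "u \<in> coordinate_polynomials c d"
  shows "continuous_on S u"
  using assms
proof (induction rule: coordinate_polynomials.induct)
  case (monomial ms a)
  have "continuous_on S (\<lambda>x :: 'n ctensor. \<Prod>(j, m)\<leftarrow>ms. x j m)"
    by (induction ms) (auto intro!: continuous_on_mult continuous_on_coordinate)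
  then show ?case by (intro continuous_on_mult continuous_on_const)
qed (rule continuous_on_add)

context cnn3_approximation
begin

lemma function_ring_coordinate_polynomials: "function_ring_on (coordinate_polynomials c d) K"
proof
  show "compact K" by (rule compact)
  show "(\<lambda>_. a) \<in> coordinate_polynomials c d" for a
    using coordinate_polynomials.monomial[of "[]" c d a] by simp
  show "\<exists>u\<in>coordinate_polynomials c d. u x \<noteq> u y" if "x \<in> K" "y \<in> K" "x \<noteq> y" for x y
  proof -
    obtain j m where jm: "x j m \<noteq> y j m" using \<open>x \<noteq> y\<close> by (auto simp: fun_eq_iff)
    have "j \<in> {1..c} \<and> m \<in> indices d"
    proof (rule ccontr)
      assume "\<not> (j \<in> {1..c} \<and> m \<in> indices d)"
      then have "x j m = 0" "y j m = 0"
        using that K_subset ctensors_eq_0 by blast+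
      then show False using jm by simp
    qed
    then have "(\<lambda>x. 1 * (\<Prod>(j, m)\<leftarrow>[(j, m)]. x j m)) \<in> coordinate_polynomials c d"
      by (intro coordinate_polynomials.monomial) auto
    then show ?thesis using jm by (intro bexI) auto
  qed
qed (auto intro: continuous_on_coordinate_polynomials coordinate_polynomials.add coordinate_polynomials_mult)

text \<open>The requirements on q decouple over the directions, so
  \<open>intermediate_position\<close> is applied in each direction t with extent
  \<open>d $ t\<close> and the common maximum \<open>d $ s\<close>.\<close>

lemma approx_monomial_min_depth:
  assumes d: "\<And>t. d $ t \<ge> 1" and p: "p \<in> indices d"
    and ms: "\<And>j m. (j, m) \<in> set ms \<Longrightarrow> j \<in> {1..c} \<and> m \<in> indices d"
  shows "approx (min_depth d) (\<lambda>x i. if i = p then \<Prod>(j, m)\<leftarrow>ms. x j m else 0)"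
proof -
  obtain s where s: "\<And>t. d $ t \<le> d $ s"
    "int (min_depth d) = (if int (d $ s) \<le> 2 then 2 else if int (d $ s) = 3 then 3 else int (d $ s) - 1)"
    using min_depth_eq[OF d] by blast
  define n where "n = min_depth d - 1"
  have n: "n \<ge> 1" "Suc n = min_depth d" "int n = int (min_depth d) - 1"
    using s(2) by (auto simp: n_def split: if_splits)
  define A where "A t = (\<lambda>(j, m). m $ t) ` set ms" for t
  have "\<exists>q. 1 \<le> q \<and> q \<le> int (d $ t) \<and> \<bar>p $ t - q\<bar> \<le> 1 \<and> (\<forall>m\<in>A t. \<bar>m - q\<bar> \<le> int (min_depth d) - 1) \<and>
    (int (d $ t) \<in> A t \<or> int (d $ t) - q \<le> int (min_depth d) - 2 \<or> q \<le> int (min_depth d) - 2 \<or> p $ t = int (d $ t)) \<and>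
    (1 \<in> A t \<or> q - 1 \<le> int (min_depth d) - 2 \<or> int (d $ t) + 1 - q \<le> int (min_depth d) - 2 \<or> p $ t = 1)" for t
  proof (rule intermediate_position[OF _ _ _ _ _ s(2)])
    show "1 \<le> m \<and> m \<le> int (d $ t)" if "m \<in> A t" for m
      using that ms by (force simp: A_def indices_def)
  qed (use d[of t] s(1)[of t] p in \<open>auto simp: indices_def\<close>)
  then obtain q where q: "\<And>t. 1 \<le> q t \<and> q t \<le> int (d $ t)" "\<And>t. \<bar>p $ t - q t\<bar> \<le> 1"
    "\<And>t m. m \<in> A t \<Longrightarrow> \<bar>m - q t\<bar> \<le> int n"
    "\<And>t. int (d $ t) \<in> A t \<or> int (d $ t) - q t \<le> int n - 1 \<or> q t \<le> int n - 1 \<or> p $ t = int (d $ t)"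
    "\<And>t. 1 \<in> A t \<or> q t - 1 \<le> int n - 1 \<or> int (d $ t) + 1 - q t \<le> int n - 1 \<or> p $ t = 1"
    unfolding n(3) by (simp only: diff_diff_eq one_add_one) metis
  have "approx (Suc n) (\<lambda>x i. if i = p then \<Prod>(j, m)\<leftarrow>ms. x j m else 0)"
  proof (rule approx_monomial[OF n(1) p _ ms, of "\<chi> t. q t"])
    show "(\<exists>(j, m)\<in>set ms. m $ t = int (d $ t)) \<or> int (d $ t) - (\<chi> t. q t) $ t \<le> int n - 1 \<or>
        (\<chi> t. q t) $ t \<le> int n - 1 \<or> p $ t = int (d $ t)" for t
      using q(4)[of t] by (force simp: A_def)
    show "(\<exists>(j, m)\<in>set ms. m $ t = 1) \<or> (\<chi> t. q t) $ t - 1 \<le> int n - 1 \<or>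
        int (d $ t) + 1 - (\<chi> t. q t) $ t \<le> int n - 1 \<or> p $ t = 1" for t
      using q(5)[of t] by (force simp: A_def)
    show "\<bar>m $ t - (\<chi> t. q t) $ t\<bar> \<le> int n" if "(j, m) \<in> set ms" for j m t
      using q(3)[of "m $ t" t] that by (force simp: A_def)
  qed (use q in \<open>auto simp: indices_def\<close>)
  then show ?thesis unfolding n(2) .
qed

text \<open>Stone-Weierstrass handles each output position by itself; the finitely many one-position
  maps are then added.\<close>

lemma approx_continuous:
  assumes d: "\<And>t. d $ t \<ge> 1" and F: "\<And>i. i \<in> indices d \<Longrightarrow> continuous_on K (\<lambda>x. F x i)"
  shows "approx (min_depth d) F"
proof -
  obtain s where "int (min_depth d) =
      (if int (d $ s) \<le> 2 then 2 else if int (d $ s) = 3 then 3 else int (d $ s) - 1)"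
    using min_depth_eq[OF d] by blast
  then have N: "min_depth d \<ge> 1" by (auto split: if_splits)
  have poly: "approx (min_depth d) (\<lambda>x i. if i = p then u x else 0)"
    if p: "p \<in> indices d" and u: "u \<in> coordinate_polynomials c d" for p u
    using u
  proof (induction rule: coordinate_polynomials.induct)
    case (monomial ms a)
    then have "approx (min_depth d) (\<lambda>x i. a * (if i = p then \<Prod>(j, m)\<leftarrow>ms. x j m else 0))"
      by (intro approx_scale approx_monomial_min_depth d p)
    then show ?case by (rule approx_cong) simp
  next
    case (add u v)
    from approx_add[OF add.IH] show ?case by (rule approx_cong) simp
  qed
  have point: "approx (min_depth d) (\<lambda>x i. if i = p then F x i else 0)" if p: "p \<in> indices d" for p
  proof (rule approx_closed)
    fix e :: real assume "e > 0"
    then obtain u where "u \<in> coordinate_polynomials c d" "\<And>x. x \<in> K \<Longrightarrow> \<bar>F x p - u x\<bar> < e"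
      using function_ring_on.Stone_Weierstrass_basic[OF function_ring_coordinate_polynomials F[OF p]]
      by metis
    then show "\<exists>\<psi>. approx (min_depth d) \<psi> \<and>
        (\<forall>x\<in>K. \<forall>i\<in>indices d. \<bar>\<psi> x i - (if i = p then F x i else 0)\<bar> \<le> e)"
      using \<open>e > 0\<close> poly[OF p]
      by (intro exI[of _ "\<lambda>x i. if i = p then u x else 0"]) (auto simp: abs_minus_commute less_imp_le)
  qed
  show ?thesis
    by (rule approx_cong[OF approx_sum[OF N finite_indices[of d] point]], assumption) simp
qed

end

section \<open>The uniform closure in terms of entrywise errors\<close>

lemma compactin_ctensors:
  "compactin (ctensor_topology c d) K \<longleftrightarrow> compact K \<and> K \<subseteq> ctensors c d"
  by (auto simp: ctensor_topology_eq compactin_subtopology)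

text \<open>Boundedness, part of the library's function space, is automatic on compact K.\<close>

lemma mspace_C_space:
  assumes "compactin (ctensor_topology c d) K"
  shows "f \<in> mspace (C_space K c c' d) \<longleftrightarrow>
    f \<in> extensional K \<and> f \<in> K \<rightarrow> ctensors c' d \<and> continuous_on K f"
proof -
  have K: "compact K" "K \<subseteq> ctensors c d" using assms by (auto simp: compactin_ctensors)
  have top: "subtopology (ctensor_topology c d) K = top_of_set K"
    using K by (simp add: ctensor_topology_eq subtopology_subtopology Int_absorb1)
  have "compactin (top_of_set K) (topspace (top_of_set K))"
    using K by (simp add: compactin_subtopology)
  from compactin_mspace_cfunspace[OF this, of "ctensor_metric c' d"] show ?thesis
    unfolding C_space_def top by (auto simp: ctensor_topology_eq)
qed

text \<open>Described with closed balls, the closure turns the supremum metric into entrywise bounds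
  of the kind used in \<open>approx\<close>.\<close>

lemma cnn_closure_iff:
  assumes K: "compactin (ctensor_topology c d) K" and cont: "continuous_on UNIV \<sigma>"
  shows "f \<in> cnn_closure \<sigma> d k N c c' K \<longleftrightarrow> f \<in> mspace (C_space K c c' d) \<and>
    (\<forall>e>0. \<exists>g\<in>cnns \<sigma> d k N c c'. \<forall>x\<in>K. \<forall>j\<in>{1..c'}. \<forall>i\<in>indices d. \<bar>f x j i - g x j i\<bar> \<le> e)"
proof -
  let ?m = "C_space K c c' d"
  interpret Metric_space "mspace ?m" "mdist ?m" by simp
  have top: "topspace (subtopology (ctensor_topology c d) K) = K"
    using K unfolding compactin_ctensors by (auto simp: ctensor_topology_eq)
  have cnn: "restrict g K \<in> mspace ?m" if "g \<in> cnns \<sigma> d k N c c'" for g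
  proof -
    have g: "is_cnn \<sigma> d k c N c' g" using that by (simp add: cnns_def)
    then have "continuous_on K (restrict g K)"
      using continuous_on_cnn[OF g cont, of K] by (simp cong: continuous_on_cong)
    then show ?thesis
      using is_cnn_ctensors[OF g] by (auto simp: mspace_C_space[OF K])
  qed
  have dist: "mdist ?m f (restrict g K) \<le> e \<longleftrightarrow>
      (\<forall>x\<in>K. \<forall>j\<in>{1..c'}. \<forall>i\<in>indices d. \<bar>f x j i - g x j i\<bar> \<le> e)"
    if f: "f \<in> mspace ?m" and g: "g \<in> cnns \<sigma> d k N c c'" and e: "e > 0" for g e
  proof -
    have "mdist ?m f (restrict g K) \<le> e \<longleftrightarrow>
        (\<forall>x\<in>K. mdist (ctensor_metric c' d) (f x) (restrict g K x) \<le> e)"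
      using mdist_cfunspace_imp_mdist_le[OF f[unfolded C_space_def] cnn[OF g, unfolded C_space_def], of e]
        mdist_cfunspace_le[of e "subtopology (ctensor_topology c d) K" "ctensor_metric c' d" f "restrict g K"]
        e unfolding C_space_def top by (meson less_imp_le)
    then show ?thesis using e by (auto simp: sup_norm_le_iff)
  qed
  have "f \<in> cnn_closure \<sigma> d k N c c' K \<longleftrightarrow> f \<in> mspace ?m \<and>
      (\<forall>e>0. \<exists>g\<in>cnns \<sigma> d k N c c'. restrict g K \<in> mcball f e)"
    unfolding cnn_closure_def mtopology_of_def metric_closure_of_alt by auto
  then show ?thesis using cnn dist by (auto simp: in_mcball)
qed

lemma universal_at_min_depth:
  fixes d :: "nat ^ 'n"
  assumes d: "\<And>t. d $ t \<ge> 1" and c': "c' \<ge> 1" and cont: "continuous_on UNIV \<sigma>"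
    and nonpoly: "\<not> (\<exists>p. \<forall>x. \<sigma> x = poly p x)" and K: "compactin (ctensor_topology c d) K"
  shows "cnn_closure \<sigma> d (\<chi> t. 1) (min_depth d) c c' K = mspace (C_space K c c' d)"
proof (intro equalityI subsetI)
  fix f assume f: "f \<in> mspace (C_space K c c' d)"
  interpret cnn3_approximation \<sigma> d c K
    using K cont nonpoly by unfold_locales (auto simp: compactin_ctensors)
  have "continuous_on K f" using f mspace_C_space[OF K] by blast
  then have "continuous_on K (\<lambda>x. f x j i)" for j i
    using continuous_on_compose2[OF continuous_on_coordinate[of UNIV], of K f] by simp
  then have "approx (min_depth d) (\<lambda>x. f x j)" for j
    by (intro approx_continuous d)
  then have approx: "\<forall>e>0. \<exists>g. is_cnn \<sigma> d (\<chi> t. 1) c (min_depth d) 1 g \<and>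
     (\<forall>x\<in>K. \<forall>i\<in>indices d. \<bar>g x 1 i - f x j i\<bar> \<le> e)" for j
    unfolding approx_def by blast
  have "\<exists>g\<in>cnns \<sigma> d (\<chi> t. 1) (min_depth d) c c'. \<forall>x\<in>K. \<forall>j\<in>{1..c'}. \<forall>i\<in>indices d. \<bar>f x j i - g x j i\<bar> \<le> e"
    if "e > 0" for e
  proof -
    have "\<exists>g. is_cnn \<sigma> d (\<chi> t. 1) c (min_depth d) 1 g \<and>
        (\<forall>x\<in>K. \<forall>i\<in>indices d. \<bar>g x 1 i - f x j i\<bar> \<le> e)" for j
      using approx[of j] \<open>e > 0\<close> by blast
    then obtain G where G: "\<And>j. is_cnn \<sigma> d (\<chi> t. 1) c (min_depth d) 1 (G j)"
      "\<And>j x i. \<lbrakk>x \<in> K; i \<in> indices d\<rbrakk> \<Longrightarrow> \<bar>G j x 1 i - f x j i\<bar> \<le> e"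
      by metis
    have "\<exists>g. is_cnn \<sigma> d (\<chi> t. 1) c (min_depth d) c' g \<and> (\<forall>x. \<forall>j\<in>{1..c'}. g x j = G j x 1)"
      by (rule is_cnn_stack[OF c' G(1)])
    then obtain g where "is_cnn \<sigma> d (\<chi> t. 1) c (min_depth d) c' g" "\<And>x j. j \<in> {1..c'} \<Longrightarrow> g x j = G j x 1"
      by blast
    then show ?thesis using G(2) by (intro bexI[of _ g]) (auto simp: cnns_def abs_minus_commute)
  qed
  then show "f \<in> cnn_closure \<sigma> d (\<chi> t. 1) (min_depth d) c c' K"
    using f by (auto simp: cnn_closure_iff[OF K cont])
qed (simp add: cnn_closure_iff[OF K cont])

section \<open>Obstructions below the minimal depth\<close>

text \<open>A linear relation between finitely many output entries survives uniform limits, so a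
  target violating it lies outside the closure.\<close>

lemma linear_obstruction:
  fixes X :: "nat \<Rightarrow> 'n::finite ctensor"
  assumes K: "compactin (ctensor_topology c d) K" and cont: "continuous_on UNIV \<sigma>" and c': "c' \<ge> 1"
    and X: "\<And>a. a < n \<Longrightarrow> X a \<in> K" and P: "\<And>a. a < n \<Longrightarrow> P a \<in> indices d"
    and rel: "\<And>g. is_cnn \<sigma> d k c N c' g \<Longrightarrow> (\<Sum>a<n. \<kappa> a * g (X a) 1 (P a)) = 0"
    and f: "f \<in> cnn_closure \<sigma> d k N c c' K"
  shows "(\<Sum>a<n. \<kappa> a * f (X a) 1 (P a)) = 0"
proof (rule ccontr)
  let ?s = "\<Sum>a<n. \<kappa> a * f (X a) 1 (P a)"
  define C where "C = (\<Sum>a<n. \<bar>\<kappa> a\<bar>) + 1"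
  have C: "C > 0" by (simp add: C_def add_nonneg_pos sum_nonneg)
  assume "?s \<noteq> 0"
  \<comment> \<open>An approximation within e changes the sum by at most C e, which is half of its
    absolute value.\<close>
  define e where "e = \<bar>?s\<bar> / (2 * C)"
  have e: "e > 0" "C * e = \<bar>?s\<bar> / 2"
    using C \<open>?s \<noteq> 0\<close> by (auto simp: e_def)
  obtain g where g: "is_cnn \<sigma> d k c N c' g"
    "\<And>x j i. \<lbrakk>x \<in> K; j \<in> {1..c'}; i \<in> indices d\<rbrakk> \<Longrightarrow> \<bar>f x j i - g x j i\<bar> \<le> e"
    using f e(1) unfolding cnn_closure_iff[OF K cont] cnns_def by blast
  have "\<bar>?s\<bar> = \<bar>\<Sum>a<n. \<kappa> a * (f (X a) 1 (P a) - g (X a) 1 (P a))\<bar>"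
    using rel[OF g(1)] by (simp add: right_diff_distrib sum_subtractf)
  also have "\<dots> \<le> (\<Sum>a<n. \<bar>\<kappa> a\<bar> * e)"
    using g(2) X P c' by (intro order_trans[OF sum_abs] sum_mono) (auto simp: abs_mult intro!: mult_left_mono)
  also have "\<dots> = (\<Sum>a<n. \<bar>\<kappa> a\<bar>) * e"
    by (rule sum_distrib_right[symmetric])
  also have "\<dots> \<le> C * e"
    using e by (intro mult_right_mono) (auto simp: C_def)
  finally show False using \<open>?s \<noteq> 0\<close> e(2) by simp
qed

text \<open>Serves both as test input and, in \<open>single_entry_target\<close>, as the value of
  the target function.\<close>

definition single_entry :: "int ^ 'n \<Rightarrow> real \<Rightarrow> 'n ctensor" where
  "single_entry m a = (\<lambda>j i. if j = 1 \<and> i = m then a else 0)"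

lemma single_entry_ctensors: "\<lbrakk>m \<in> indices d; c \<ge> 1\<rbrakk> \<Longrightarrow> single_entry m a \<in> ctensors c d"
  by (auto simp: single_entry_def ctensors_def)

lemma single_entry_target:
  fixes d :: "nat ^ 'n" and h :: "real \<Rightarrow> real"
  assumes "compactin (ctensor_topology c d) K" "continuous_on UNIV h" "p \<in> indices d" "c' \<ge> 1"
  shows "restrict (\<lambda>x. single_entry p (h (x 1 m))) K \<in> mspace (C_space K c c' d)"
proof -
  have "continuous_on K (\<lambda>x :: 'n ctensor. single_entry p (h (x 1 m)))"
  proof (rule continuous_on_ctensorI)
    fix j i
    have "continuous_on K (\<lambda>x :: 'n ctensor. h (x 1 m))"
      by (rule continuous_on_compose2[OF assms(2) continuous_on_coordinate]) auto
    then show "continuous_on K (\<lambda>x :: 'n ctensor. single_entry p (h (x 1 m)) j i)"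
      by (cases "j = 1 \<and> i = p") (auto simp: single_entry_def)
  qed
  then have "continuous_on K (restrict (\<lambda>x :: 'n ctensor. single_entry p (h (x 1 m))) K)"
    by (simp cong: continuous_on_cong)
  then show ?thesis
    using single_entry_ctensors[OF assms(3,4)] by (auto simp: mspace_C_space[OF assms(1)])
qed

text \<open>A finite K is enough: it consists of the test inputs, and the target that places h of
  the entry m at position p violates the relation.\<close>

lemma not_universal:
  fixes d :: "nat ^ 'n" and X :: "nat \<Rightarrow> 'n ctensor"
  assumes cont: "continuous_on UNIV \<sigma>" and c': "c' \<ge> 1" and h: "continuous_on UNIV h"
    and X: "\<And>a. a < n \<Longrightarrow> X a \<in> ctensors c d" and P: "\<And>a. a < n \<Longrightarrow> P a \<in> indices d"
    and p: "p \<in> indices d"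
    and rel: "\<And>g. is_cnn \<sigma> d k c N c' g \<Longrightarrow> (\<Sum>a<n. \<kappa> a * g (X a) 1 (P a)) = 0"
    and ne: "(\<Sum>a<n. \<kappa> a * (if P a = p then h (X a 1 m) else 0)) \<noteq> 0"
  shows "\<exists>K. compactin (ctensor_topology c d) K \<and>
    \<not> mspace (C_space K c c' d) \<subseteq> cnn_closure \<sigma> d k N c c' K"
proof (intro exI conjI notI)
  let ?K = "X ` {..<n}"
  let ?f = "restrict (\<lambda>x. single_entry p (h (x 1 m))) ?K"
  show K: "compactin (ctensor_topology c d) ?K"
    using X by (auto simp: compactin_ctensors intro!: finite_imp_compact)
  assume "mspace (C_space ?K c c' d) \<subseteq> cnn_closure \<sigma> d k N c c' ?K"
  then have f: "?f \<in> cnn_closure \<sigma> d k N c c' ?K"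
    using single_entry_target[OF K h p c'] by blast
  have "(\<Sum>a<n. \<kappa> a * ?f (X a) 1 (P a)) = 0"
  proof (rule linear_obstruction[OF K cont c' _ _ _ f])
    show "X a \<in> ?K" if "a < n" for a using that by simp
    show "P a \<in> indices d" if "a < n" for a using that by (rule P)
    show "(\<Sum>a<n. \<kappa> a * g (X a) 1 (P a)) = 0" if "is_cnn \<sigma> d k c N c' g" for g
      using that by (rule rel)
  qed
  moreover have "(\<Sum>a<n. \<kappa> a * ?f (X a) 1 (P a)) = (\<Sum>a<n. \<kappa> a * (if P a = p then h (X a 1 m) else 0))"
    by (intro sum.cong) (auto simp: single_entry_def)
  ultimately show False using ne by simp
qed

section \<open>Response of networks to a single input entry\<close>

lemma conv_layer_single_entry:
  assumes "c \<ge> 1" "l \<in> {1..c2}" "i \<in> indices d"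
  shows "conv_layer d k c c2 w \<delta> (single_entry m a) l i
    = a * (if i - m \<in> kernel_range k then w l 1 (i - m) else 0) + \<delta> l"
proof -
  have conv: "conv d k (w l j) (single_entry m a j) i
      = (if j = 1 then a * (if i - m \<in> kernel_range k then w l 1 (i - m) else 0) else 0)" for j
  proof (cases "j = 1")
    case True
    have "(\<Sum>q\<in>kernel_range k. w l 1 q * single_entry m a 1 (i - q))
        = (\<Sum>q\<in>kernel_range k. if q = i - m then a * w l 1 q else 0)"
      by (intro sum.cong) (auto simp: single_entry_def)
    then show ?thesis using True assms(3) by (simp add: conv_def)
  next
    case False
    then show ?thesis by (simp add: conv_def single_entry_def)
  qed
  have "(\<Sum>j = 1..c. conv d k (w l j) (single_entry m a j) i)
      = a * (if i - m \<in> kernel_range k then w l 1 (i - m) else 0)"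
    unfolding conv using assms(1) by simp
  then show ?thesis using assms(2,3) by (simp add: conv_layer_def ones_def)
qed

text \<open>Receptive field: every layer of radius one adds one position in each direction.\<close>

lemma is_cnn_local:
  assumes "is_cnn \<sigma> d (\<chi> t. 1) c N m f"
    and "\<And>j i. (\<And>t. \<bar>i $ t - p $ t\<bar> \<le> int N) \<Longrightarrow> x j i = y j i"
  shows "f x l p = f y l p"
  using assms
proof (induction arbitrary: l p rule: is_cnn.induct)
  case (single C c')
  then obtain w \<delta> where C: "C = conv_layer d (\<chi> t. 1) c c' w \<delta>" by (auto simp: conv_layers_def)
  have "conv d (\<chi> t. 1) w' (x j) p = conv d (\<chi> t. 1) w' (y j) p" for w' j
    unfolding conv_def using single.prems
    by (auto intro!: sum.cong simp: kernel_range_def)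
  then show ?case by (simp add: C conv_layer_def)
next
  case (layer N m f C c')
  then obtain w \<delta> where C: "C = conv_layer d (\<chi> t. 1) m c' w \<delta>" by (auto simp: conv_layers_def)
  have f: "f x l (p - q) = f y l (p - q)" if q: "q \<in> kernel_range (\<chi> t. 1)" for l q
  proof (rule layer.IH)
    fix j i assume i: "\<And>t. \<bar>i $ t - (p - q) $ t\<bar> \<le> int N"
    show "x j i = y j i"
    proof (rule layer.prems)
      fix t
      show "\<bar>i $ t - p $ t\<bar> \<le> int (Suc N)"
        using i[of t] q by (auto simp: kernel_range_def dest!: spec[of _ t])
    qed
  qed
  have "conv d (\<chi> t. 1) w' (activate \<sigma> m d (f x) j) p = conv d (\<chi> t. 1) w' (activate \<sigma> m d (f y) j) p" for w' j
    unfolding conv_def activate_def by (auto intro!: sum.cong simp: f)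
  then show ?case by (simp add: C conv_layer_def)
qed

text \<open>Moving the input entry \<open>m\<close> and the output position \<open>p\<close> by the same unit vector changes a
  depth-two network only through the hidden entries that are shifted into the tensor; these do not
  see the moved input entry.\<close>

lemma depth_2_shift:
  assumes "is_cnn \<sigma> d (\<chi> t. 1) c 2 c' f" and c: "c \<ge> 1"
    and s: "d $ s = 3" and m: "m $ s = 2" and p: "p $ s = 1" "p \<in> indices d" 
  shows "f (single_entry (m + axis s 1) a) l (p + axis s 1) - f (single_entry m a) l p
    = f (single_entry (m + axis s 1) 0) l (p + axis s 1) - f (single_entry m 0) l p"
proof -
  let ?v = "axis s 1 :: int ^ 'a"
  let ?k = "(\<chi> t. 1) :: nat ^ 'a"
  obtain c1 C1 C2 where f: "f = C2 \<circ> activate \<sigma> c1 d \<circ> C1" "C1 \<in> conv_layers d ?k c c1"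
    "C2 \<in> conv_layers d ?k c1 c'"
    using assms(1)
    by cases (auto simp: numeral_2_eq_2 is_cnn_1_iff)
  obtain w1 \<delta>1 w2 \<delta>2 where C: "C1 = conv_layer d ?k c c1 w1 \<delta>1" "C2 = conv_layer d ?k c1 c' w2 \<delta>2"
    using f by (auto simp: conv_layers_def)
  define A where "A a = activate \<sigma> c1 d (C1 (single_entry (m + ?v) a))" for a
  define B where "B a = activate \<sigma> c1 d (C1 (single_entry m a))" for a
  have pv: "p + ?v \<in> indices d" using p s by (auto simp: indices_def axis_def)
  have AB: "A a j (p + ?v - r) - B a j (p - r) = A 0 j (p + ?v - r) - B 0 j (p - r)"
    if r: "r \<in> kernel_range ?k" for j r
  proof -
    let ?q = "p - r"
    have qs: "0 \<le> ?q $ s" "?q $ s \<le> 2"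
      using r p by (auto simp: kernel_range_def dest!: spec[of _ s])
    have shift: "?q + ?v - (m + ?v) = ?q - m" by simp
    have swap: "p + ?v - r = ?q + ?v" by simp
    \<comment> \<open>Since \<open>d $ s = 3\<close> and the coordinate s of \<open>?q\<close> is at
      most 2, no relevant hidden entry leaves the tensor under the shift.\<close>
    have iff: "?q + ?v \<in> indices d" if "?q \<in> indices d"
      using that qs s by (auto simp: indices_def axis_def)
    show ?thesis
    proof (cases "j \<in> {1..c1}")
      case j: True
      have A: "A a j i = (if i \<in> indices d then
          \<sigma> (a * (if i - (m + ?v) \<in> kernel_range ?k then w1 j 1 (i - (m + ?v)) else 0) + \<delta>1 j) else 0)" for a i
        using j by (simp add: A_def activate_def C conv_layer_single_entry[OF c])
      have B: "B a j i = (if i \<in> indices d then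
          \<sigma> (a * (if i - m \<in> kernel_range ?k then w1 j 1 (i - m) else 0) + \<delta>1 j) else 0)" for a i
        using j by (simp add: B_def activate_def C conv_layer_single_entry[OF c])
      show ?thesis
      proof (cases "?q \<in> indices d")
        case True
        then show ?thesis using iff unfolding swap A B shift by simp
      next
        case False
        show ?thesis
        proof (cases "?q + ?v \<in> indices d")
          case True
          \<comment> \<open>Only here does a hidden entry enter the tensor under the shift. Before
            the shift its coordinate s is below 1 while that of m is 2, so the kernel does not reach
            m and the entry is independent of a.\<close>
          have "?q $ s < 1"
          proof (rule ccontr)
            assume "\<not> ?q $ s < 1"
            then have "1 \<le> ?q $ t \<and> ?q $ t \<le> int (d $ t)" for t
              using True qs s
              by (cases "t = s") (auto simp: indices_def axis_def dest: spec[of _ t] split: if_splits)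
            then have "?q \<in> indices d" by (simp add: indices_def)
            then show False using False by simp
          qed
          then have "(?q - m) $ s < - 1" using m by simp
          then have "?q - m \<notin> kernel_range ?k"
            by (auto simp: kernel_range_def intro!: exI[of _ s])
          then show ?thesis unfolding swap A B shift by simp
        next
          case False
          then show ?thesis using \<open>?q \<notin> indices d\<close> unfolding swap A B by simp
        qed
      qed
    qed (simp only: A_def B_def activate_def simp_thms if_False)
  qed
  have conv: "conv d ?k w (A a j) (p + ?v) - conv d ?k w (B a j) p
      = conv d ?k w (A 0 j) (p + ?v) - conv d ?k w (B 0 j) p" for w j
    using pv p AB by (simp add: conv_def flip: sum_subtractf right_diff_distrib)
  show ?thesis
  proof (cases "l \<in> {1..c'}")
    case True
    have "C2 (A a) l (p + ?v) - C2 (B a) l p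
        = (\<Sum>j = 1..c1. conv d ?k (w2 l j) (A a j) (p + ?v) - conv d ?k (w2 l j) (B a j) p)" for a
      using True p pv by (simp add: C conv_layer_def ones_def sum_subtractf)
    then have "C2 (A a) l (p + ?v) - C2 (B a) l p = C2 (A 0) l (p + ?v) - C2 (B 0) l p"
      by (simp only: conv)
    then show ?thesis by (simp add: f A_def B_def)
  qed (simp only: f C comp_def conv_layer_def simp_thms if_False)
qed

lemma not_universal_below_min_depth:
  fixes d :: "nat ^ 'n"
  assumes d: "\<And>t. d $ t \<ge> 1" and c: "c \<ge> 1" and c': "c' \<ge> 1" and cont: "continuous_on UNIV \<sigma>"
  shows "\<exists>K. compactin (ctensor_topology c d) K \<and>
    \<not> mspace (C_space K c c' d) \<subseteq> cnn_closure \<sigma> d (\<chi> t. 1) (min_depth d - 1) c c' K"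
proof -
  obtain s where N: "int (min_depth d) =
      (if int (d $ s) \<le> 2 then 2 else if int (d $ s) = 3 then 3 else int (d $ s) - 1)"
    using min_depth_eq[OF d] by blast
  let ?p = "(\<chi> t. 1) :: int ^ 'n"
  have "1 \<le> int (d $ t)" for t using d[of t] by simp
  then have p: "?p \<in> indices d" by (simp add: indices_def)
  have axis: "?p + axis s a \<in> indices d" if "0 \<le> a" "a < int (d $ s)" for a
    using p that by (auto simp: indices_def axis_def)
  consider "d $ s \<le> 2" | "d $ s = 3" | "d $ s \<ge> 4" by linarith
  then show ?thesis
  proof cases
    case 1
    with N have N1: "min_depth d - 1 = 1" by simp
    \<comment> \<open>The second difference with weights 1, -2, 1 annihilates the affine maps of one
      layer, but not the square used as target.\<close>
    have rel: "(\<Sum>a<3. (if a = 1 then -2 else 1) * g (single_entry ?p (real a)) 1 ?p) = 0"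
      if g: "is_cnn \<sigma> d (\<chi> t. 1) c 1 c' g" for g
    proof -
      obtain w \<delta> where "g = conv_layer d (\<chi> t. 1) c c' w \<delta>"
        using g by (auto simp: is_cnn_1_iff conv_layers_def)
      then show ?thesis
        using c c' p by (simp add: conv_layer_single_entry eval_nat_numeral)
    qed
    show ?thesis
      unfolding N1
    proof (rule not_universal[where n = 3 and X = "\<lambda>a. single_entry ?p (real a)" and P = "\<lambda>_. ?p"
          and \<kappa> = "\<lambda>a. if a = 1 then -2 else 1" and h = "\<lambda>y. y\<^sup>2" and p = ?p and m = ?p, OF cont c'])
      show "(\<Sum>a<3. (if a = 1 then -2 else 1) * g (single_entry ?p (real a)) 1 ?p) = 0"
        if "is_cnn \<sigma> d (\<chi> t. 1) c 1 c' g" for g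
        using that by (rule rel)
      show "(\<Sum>a<3. (if a = 1 then -2 else 1) * (if ?p = ?p then (single_entry ?p (real a) 1 ?p)\<^sup>2 else 0)) \<noteq> 0"
        by (simp add: single_entry_def eval_nat_numeral)
    qed (use c p in \<open>auto intro!: continuous_intros single_entry_ctensors\<close>)
  next
    case 2
    with N have N2: "min_depth d - 1 = 2" by simp
    let ?e = "\<lambda>a. ?p + axis s a"
    have v: "?e 1 + axis s 1 = ?e 2" by (simp add: vec_eq_iff axis_def)
    \<comment> \<open>The identity of \<open>depth_2_shift\<close> with m = \<open>?e 1\<close> and
      a = 1, written as a signed sum of four terms. The target copies the entry at
      \<open>?e 2\<close> to the output position \<open>?e 1\<close>, so only the first term
      survives, with value 1.\<close>
    define X where "X a = [single_entry (?e 2) 1, single_entry (?e 1) 1, single_entry (?e 2) 0, single_entry (?e 1) 0] ! a" for a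
    define P where "P a = [?e 1, ?p, ?e 1, ?p] ! a" for a
    define \<kappa> where "\<kappa> a = [1, -1, -1, 1 :: real] ! a" for a
    have lt4: "a < 4 \<longleftrightarrow> a = 0 \<or> a = 1 \<or> a = 2 \<or> a = 3" for a :: nat by auto
    have sum4: "(\<Sum>a<4. F a) = F 0 + F 1 + F 2 + F 3" for F :: "nat \<Rightarrow> real"
      by (simp add: eval_nat_numeral)
    have rel: "(\<Sum>a<4. \<kappa> a * g (X a) 1 (P a)) = 0" if "is_cnn \<sigma> d (\<chi> t. 1) c 2 c' g" for g
      using depth_2_shift[OF that c 2, of "?e 1" ?p 1 1] p
      unfolding v sum4 by (simp add: X_def P_def \<kappa>_def axis_def numeral_3_eq_3)
    have e1: "?e 1 \<noteq> ?p" "?e 2 \<noteq> ?e 1" by (auto simp: vec_eq_iff axis_def)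
    show ?thesis
      unfolding N2
    proof (rule not_universal[where n = 4 and X = X and P = P and \<kappa> = \<kappa> and h = "\<lambda>y. y" and p = "?e 1" and m = "?e 2",
          OF cont c'])
      show "(\<Sum>a<4. \<kappa> a * g (X a) 1 (P a)) = 0" if "is_cnn \<sigma> d (\<chi> t. 1) c 2 c' g" for g
        using that by (rule rel)
      show "(\<Sum>a<4. \<kappa> a * (if P a = ?e 1 then X a 1 (?e 2) else 0)) \<noteq> 0"
        unfolding sum4 using e1 by (simp add: X_def P_def \<kappa>_def single_entry_def numeral_3_eq_3)
      show "X a \<in> ctensors c d" if "a < 4" for a
        using that c axis[of 1] axis[of 2] 2 unfolding lt4
        by (auto simp: X_def numeral_3_eq_3 intro!: single_entry_ctensors)
      show "P a \<in> indices d" if "a < 4" for a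
        using that axis[of 1] p 2 unfolding lt4 by (auto simp: P_def numeral_3_eq_3)
    qed (use 2 axis[of 1] in \<open>auto intro: continuous_on_id\<close>)
  next
    case 3
    \<comment> \<open>The distance to \<open>?p\<close> is \<open>d $ s - 1\<close>, one more than
      the depth \<open>d $ s - 2\<close>.\<close>
    let ?m = "?p + axis s (int (d $ s) - 1)"
    have m: "?m \<in> indices d" using 3 by (intro axis) auto
    have rel: "(\<Sum>a<2. (if a = 0 then -1 else 1) * g (single_entry ?m (real a)) 1 ?p) = 0"
      if g: "is_cnn \<sigma> d (\<chi> t. 1) c (min_depth d - 1) c' g" for g
    proof -
      have "g (single_entry ?m 0) 1 ?p = g (single_entry ?m 1) 1 ?p"
      proof (rule is_cnn_local[OF g])
        fix j and i :: "int ^ 'n"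
        assume i: "\<And>t. \<bar>i $ t - ?p $ t\<bar> \<le> int (min_depth d - 1)"
        have "i \<noteq> ?m" using i[of s] N 3 by (auto simp: axis_def)
        then show "single_entry ?m 0 j i = single_entry ?m 1 j i" by (simp add: single_entry_def)
      qed
      then show ?thesis by (simp add: eval_nat_numeral)
    qed
    show ?thesis
    proof (rule not_universal[where n = 2 and X = "\<lambda>a. single_entry ?m (real a)" and P = "\<lambda>_. ?p"
          and \<kappa> = "\<lambda>a. if a = 0 then -1 else 1" and h = "\<lambda>y. y" and p = ?p and m = ?m, OF cont c'])
      show "(\<Sum>a<2. (if a = 0 then -1 else 1) * g (single_entry ?m (real a)) 1 ?p) = 0"
        if "is_cnn \<sigma> d (\<chi> t. 1) c (min_depth d - 1) c' g" for g
        using that by (rule rel)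
      show "(\<Sum>a<2. (if a = 0 then -1 else 1) * (if ?p = ?p then single_entry ?m (real a) 1 ?m else 0)) \<noteq> 0"
        by (simp add: single_entry_def eval_nat_numeral)
    qed (use c p m in \<open>auto intro: continuous_on_id single_entry_ctensors\<close>)
  qed
qed

theorem theorem20:
  fixes d :: "nat ^ 'n" and c c' :: nat and \<sigma> :: "real \<Rightarrow> real"
  assumes "\<And>t. d $ t \<ge> 1" and "c \<ge> 1" and "c' \<ge> 1"
    and "continuous_on UNIV \<sigma>" and "\<not> (\<exists>p. \<forall>x. \<sigma> x = poly p x)"
  shows "(\<forall>K. compactin (ctensor_topology c d) K \<longrightarrow>
           cnn_closure \<sigma> d (\<chi> t. 1) (min_depth d) c c' K = mspace (C_space K c c' d)) \<and>
         (\<exists>K. compactin (ctensor_topology c d) K \<and>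
           \<not> mspace (C_space K c c' d) \<subseteq> cnn_closure \<sigma> d (\<chi> t. 1) (min_depth d - 1) c c' K)"
  using universal_at_min_depth[OF assms(1,3,4,5)] not_universal_below_min_depth[OF assms(1-4)]
  by blast

end
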